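(* Deductions in $\mathbf{CNF}^{\iota}{}'$ can be brought into normal form: for every deduction in $\mathbf{CNF}^{\iota}{}'$ of a formula $A$ from a set $\Gamma$ of open assumptions there is a deduction in $\mathbf{CNF}^{\iota}{}'$ of $A$, all of whose open assumptions belong to $\Gamma$, which is in normal form.
   Context: **Language.** First-order language with parameters $a,b,\ldots$ (used as free variables, distinct in shape from the bound variables $x,y,z,\ldots$), constants, predicate letters, identity $=$, a one-place existence predicate $\exists!$, $\bot,\rightarrow,\forall$, and the definite description operator $\iota$, which forms from a variable $x$ and a formula $F$ a term $\iota xF$ binding $x$; $\neg A$ is $A\rightarrow\bot$. Terms are parameters and constants (atomic terms) and $\iota$-terms (complex terms). $A_t^x$ is $A$ with $t$ replacing all free occurrences of $x$. Atomic formulas are formed by a predicate letter, $\exists!$ or $=$ from terms; they are prime if all these terms are atomic; $\bot$ is not atomic. **Rules of $\mathbf{CNF}^{\iota}{}'$** (natural deduction trees, $[A]$ marks a class of assumptions discharged by the rule, vacuous discharge allowed). $(\rightarrow I)$: from a deduction of $B$ from $[A]$ infer $A\rightarrow B$. $(\rightarrow E)$: from $A\rightarrow B$ and $A$ infer $B$. $(\bot E_C)$: from a deduction of $\bot$ from $[\neg A]$ infer $A$; with vacuous discharge it is referred to as $(\bot E)$, and below "$(\bot E_C)$" means an application with non-vacuous discharge. $(\forall I)$: from a deduction $\Pi$ of $A_a^x$ from $[\exists!a]$ infer $\forall xA$, where $a$ does not occur in $\forall xA$ nor in undischarged assumptions of $\Pi$ except those in the class of $\exists!a$. $(\forall E)$: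 from $\forall xA$ and $\exists!t$ infer $A_t^x$, $t$ atomic. $(=I^{nG})$: from $\exists!t$ (major premise) and a deduction $\Pi$ of $C$ (minor premise) from $[a=t]$ infer $C$, where $a$ does not occur in $t$, $C$ nor in open assumptions of $\Pi$ other than those in the class of $a=t$. $(=E)$: from $t_1=t_2$ and $A_{t_1}^x$ infer $A_{t_2}^x$. $(AD)$: from $Rt_1\ldots t_n$ infer $\exists!t_i$ ($1\le i\le n$), where $R$ is a predicate letter (not $\exists!$) or $=$. $(\iota I)$: from $\exists!t$, a deduction $\Xi$ of $F_a^x$ from $[a=t]$ and a deduction $\Pi$ of $a=t$ from $[F_a^x],[\exists!a]$ infer $\iota xF=t$, where $t$ is atomic and $a$ does not occur in $\iota xF$, in $t$, nor in undischarged assumptions except those in the classes of $a=t$ in $\Xi$ and of $F_a^x$, $\exists!a$ in $\Pi$. $(\iota E_1)$: from $\iota xF=t$ and $u=t$ infer $F_u^x$, $t,u$ atomic. $(\iota E_2)$: from $\iota xF=t$, $F_u^x$ and $\exists!u$ infer $u=t$, $t,u$ atomic. $(\iota E_3)$: from $\iota xF=t$ infer $\exists!t$. (An inference from the conclusion $\iota xF=t$ of $(\iota I)$ to $\exists!t$ counts as $(\iota E_3)$; one to $\exists!\,\iota xF$ counts as $(AD)$.) **Standing conventions.** Applications of $(=E)$ and of $(\bot E_C)$ have atomic conclusions, and applications of $(\bot E)$ have prime conclusions. Vacuous applications of $(=E)$ (major premise $t=t$) are assumed to be always removed. The major premise of an elimination rule is its leftmost premise in the list above, the other premises are minor. **Segments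 and normal form.** A *segment* is either (α) a sequence of formula occurrences $C_1,\ldots,C_n$ such that $C_1$ is not the conclusion, and $C_n$ not the minor premise, of $(=I^{nG})$, and for all $i<n$, $C_i$ is the minor premise of an application of $(=I^{nG})$ with conclusion $C_{i+1}$; or (β) (a *$(\bot E_C)$-segment* ) a sequence of formula occurrences $A_1,\ldots,A_n$ such that $A_1$ is not the conclusion of $(\bot E_C)$, for all $i<n$, $A_i$ is the minor premise of an application of $(\rightarrow E)$ whose major premise is discharged by an application of $(\bot E_C)$ with conclusion $A_{i+1}$, and $A_n$ is not the minor premise of an application of $(\rightarrow E)$ whose major premise is discharged by $(\bot E_C)$. The length is $n$. A segment is said to be a premise (conclusion) of a rule if its last (first) formula is. The following segments are maximal. (1) A segment of kind (α) whose last formula is the major premise of an elimination rule and which, if its length is $1$, is the conclusion of an introduction rule for the operator ($\rightarrow,\forall$ or $\iota$) which that elimination rule eliminates. (2) A segment whose last formula is the conclusion of $(\bot E_C)$ and the major premise of $(\iota E_1)$, $(\iota E_2)$ or $(\iota E_3)$ or the premise of $(AD)$. In (3)–(5) segments are of kind (α). (3) A *maximal $=$-segment*: either (i) a segment of formulas $t=t$ one of which is the minor premise of $(=I^{nG})$ and the last of which is the premise of $(AD)$ or $(\iota E_3)$, or (ii) a segment of formulas $a=t$ the first of which is discharged by $(=I^{nG})$ and the last of which is the premise of $(AD)$ or $(\iota E_3)$ with conclusion $\exists!t$. (4) A *maximal $\exists!$-segment*: a segment of formulas $\exists!t$ that is concluded from $t=t$ by $(AD)$ or $(\iota E_3)$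 and is the major premise of an application of $(=I^{nG})$ with conclusion $t=t$. (5) A *maximal $(=E)$-segment*: an $(=E)$-segment is a sequence of segments $\sigma_1,\ldots,\sigma_n$ where $\sigma_1$ is the minor premise but not the conclusion of $(=E)$, $\sigma_n$ is the conclusion but not the minor premise of $(=E)$, each $\sigma_i$ with $1<i<n$ is both, and $\sigma_{i+1}$ is concluded from minor premise $\sigma_i$; it is maximal if its last segment is the premise of $(AD)$ (or $(\iota E_3)$) or if all formulas on it are formed from $\exists!$ and a term. A deduction is in *normal form* if it contains no maximal segments of any of these kinds. *)

theory Defs
  imports Main
begin

section \<open>Language\<close>

text \<open>
  Parameters and bound variables are two disjoint sorts, each indexed by \<^typ>\<open>nat\<close>.  The datatypes
  contain quasi-terms and quasi-formulas, in which variables may occur free.  Terms and formulas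
  proper contain no free variables (\<open>formula\<close> below), so replacing a variable by a term never
  leads to capture, and no identification of alphabetic variants is needed.
\<close>

datatype ('c, 'p) tm =
    Par nat
  | Const 'c
  | Var nat
  | Iota nat "('c, 'p) fm"
and ('c, 'p) fm =
    Pred 'p "('c, 'p) tm list"
  | Existent "('c, 'p) tm"
  | Ident "('c, 'p) tm" "('c, 'p) tm"
  | Falsum
  | Imp "('c, 'p) fm" "('c, 'p) fm"
  | Forall nat "('c, 'p) fm"

abbreviation Neg :: "('c, 'p) fm \<Rightarrow> ('c, 'p) fm" where
  "Neg A \<equiv> Imp A Falsum"

text \<open>\<open>subst_fm x t A\<close> is $A_t^x$.\<close>

primrec subst_tm :: "nat \<Rightarrow> ('c, 'p) tm \<Rightarrow> ('c, 'p) tm \<Rightarrow> ('c, 'p) tm"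
  and subst_fm :: "nat \<Rightarrow> ('c, 'p) tm \<Rightarrow> ('c, 'p) fm \<Rightarrow> ('c, 'p) fm" where
  "subst_tm x t (Par a) = Par a"
| "subst_tm x t (Const c) = Const c"
| "subst_tm x t (Var y) = (if y = x then t else Var y)"
| "subst_tm x t (Iota y F) = Iota y (if y = x then F else subst_fm x t F)"
| "subst_fm x t (Pred P ts) = Pred P (map (subst_tm x t) ts)"
| "subst_fm x t (Existent s) = Existent (subst_tm x t s)"
| "subst_fm x t (Ident s1 s2) = Ident (subst_tm x t s1) (subst_tm x t s2)"
| "subst_fm x t Falsum = Falsum"
| "subst_fm x t (Imp A B) = Imp (subst_fm x t A) (subst_fm x t B)"
| "subst_fm x t (Forall y A) = Forall y (if y = x then A else subst_fm x t A)"

primrec fv_tm :: "('c, 'p) tm \<Rightarrow> nat set" and fv_fm :: "('c, 'p) fm \<Rightarrow> nat set" where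
  "fv_tm (Par a) = {}"
| "fv_tm (Const c) = {}"
| "fv_tm (Var y) = {y}"
| "fv_tm (Iota y F) = fv_fm F - {y}"
| "fv_fm (Pred P ts) = \<Union>(set (map fv_tm ts))"
| "fv_fm (Existent s) = fv_tm s"
| "fv_fm (Ident s1 s2) = fv_tm s1 \<union> fv_tm s2"
| "fv_fm Falsum = {}"
| "fv_fm (Imp A B) = fv_fm A \<union> fv_fm B"
| "fv_fm (Forall y A) = fv_fm A - {y}"

primrec params_tm :: "('c, 'p) tm \<Rightarrow> nat set" and params_fm :: "('c, 'p) fm \<Rightarrow> nat set" where
  "params_tm (Par a) = {a}"
| "params_tm (Const c) = {}"
| "params_tm (Var y) = {}"
| "params_tm (Iota y F) = params_fm F"
| "params_fm (Pred P ts) = \<Union>(set (map params_tm ts))"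
| "params_fm (Existent s) = params_tm s"
| "params_fm (Ident s1 s2) = params_tm s1 \<union> params_tm s2"
| "params_fm Falsum = {}"
| "params_fm (Imp A B) = params_fm A \<union> params_fm B"
| "params_fm (Forall y A) = params_fm A"

primrec arity_tm :: "('p \<Rightarrow> nat) \<Rightarrow> ('c, 'p) tm \<Rightarrow> bool"
  and arity_fm :: "('p \<Rightarrow> nat) \<Rightarrow> ('c, 'p) fm \<Rightarrow> bool" where
  "arity_tm ar (Par a) = True"
| "arity_tm ar (Const c) = True"
| "arity_tm ar (Var y) = True"
| "arity_tm ar (Iota y F) = arity_fm ar F"
| "arity_fm ar (Pred P ts) = (length ts = ar P \<and> list_all id (map (arity_tm ar) ts))"
| "arity_fm ar (Existent s) = arity_tm ar s"
| "arity_fm ar (Ident s1 s2) = (arity_tm ar s1 \<and> arity_tm ar s2)"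
| "arity_fm ar Falsum = True"
| "arity_fm ar (Imp A B) = (arity_fm ar A \<and> arity_fm ar B)"
| "arity_fm ar (Forall y A) = arity_fm ar A"

definition formula :: "('p \<Rightarrow> nat) \<Rightarrow> ('c, 'p) fm \<Rightarrow> bool" where
  "formula ar A \<longleftrightarrow> fv_fm A = {} \<and> arity_fm ar A"

fun atomic_tm :: "('c, 'p) tm \<Rightarrow> bool" where
  "atomic_tm (Par a) = True"
| "atomic_tm (Const c) = True"
| "atomic_tm _ = False"

fun atomic :: "('c, 'p) fm \<Rightarrow> bool" where
  "atomic (Pred P ts) = True"
| "atomic (Existent t) = True"
| "atomic (Ident s t) = True"
| "atomic _ = False"

fun prime :: "('c, 'p) fm \<Rightarrow> bool" where
  "prime (Pred P ts) = (\<forall>t\<in>set ts. atomic_tm t)"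
| "prime (Existent t) = atomic_tm t"
| "prime (Ident s t) = (atomic_tm s \<and> atomic_tm t)"
| "prime _ = False"


section \<open>Deductions\<close>

text \<open>
  An assumption carries a label; an assumption class consists of the open assumptions of a given
  formula with a given label, so that an arbitrary set of open assumptions of a formula can be
  made a class by the choice of labels.  A rule that discharges assumptions names the label and,
  if it has one, its parameter; the formulas of the discharged classes are determined by the
  inference (\<open>discharges\<close> below).  The three classes of \<open>IotaI\<close> share their label.
  \<open>BotE\<close> covers both $(\bot E_C)$ and $(\bot E)$.
\<close>

datatype rule =
    ImpI nat
  | ImpE
  | BotE nat
  | ForallI nat nat
  | ForallE
  | EqI nat nat
  | EqE
  | AD
  | IotaI nat nat
  | IotaE1
  | IotaE2
  | IotaE3

datatype ('c, 'p) ded =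
    Assume nat "('c, 'p) fm"
  | Infer rule "('c, 'p) fm" "('c, 'p) ded list"

primrec concl :: "('c, 'p) ded \<Rightarrow> ('c, 'p) fm" where
  "concl (Assume u A) = A"
| "concl (Infer r C ds) = C"

text \<open>
  \<open>discharges r C ds i\<close>: the assumption classes which the application of \<open>r\<close> with conclusion \<open>C\<close>
  and subdeductions \<open>ds\<close> discharges in the \<open>i\<close>-th subdeduction, counted from 0.
\<close>

primrec discharges ::
    "rule \<Rightarrow> ('c, 'p) fm \<Rightarrow> ('c, 'p) ded list \<Rightarrow> nat \<Rightarrow> (nat \<times> ('c, 'p) fm) set" where
  "discharges (ImpI u) C ds i = {(u, A) |A B. i = 0 \<and> C = Imp A B}"
| "discharges ImpE C ds i = {}"
| "discharges (BotE u) C ds i = (if i = 0 then {(u, Neg C)} else {})"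
| "discharges (ForallI u a) C ds i = (if i = 0 then {(u, Existent (Par a))} else {})"
| "discharges ForallE C ds i = {}"
| "discharges (EqI u a) C ds i = {(u, Ident (Par a) t) |t. i = 1 \<and> concl (ds ! 0) = Existent t}"
| "discharges EqE C ds i = {}"
| "discharges AD C ds i = {}"
| "discharges (IotaI u a) C ds i =
     {(u, B) |B x F t. C = Ident (Iota x F) t \<and>
        (i = 1 \<and> B = Ident (Par a) t \<or>
         i = 2 \<and> (B = subst_fm x (Par a) F \<or> B = Existent (Par a)))}"
| "discharges IotaE1 C ds i = {}"
| "discharges IotaE2 C ds i = {}"
| "discharges IotaE3 C ds i = {}"

function open_asms :: "('c, 'p) ded \<Rightarrow> (nat \<times> ('c, 'p) fm) set" where
  "open_asms (Assume u A) = {(u, A)}"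
| "open_asms (Infer r C ds) =
     (\<Union>i\<in>{..<length ds}. open_asms (ds ! i) - discharges r C ds i)"
  by pat_completeness auto
termination
  by (relation "measure size") (auto simp: less_Suc_eq_le intro!: trans_le_add2 size_list_estimation'[OF nth_mem])

definition open_formulas :: "('c, 'p) ded \<Rightarrow> ('c, 'p) fm set" where
  "open_formulas D = snd ` open_asms D"

text \<open>
  The deductions of $\mathbf{CNF}^{\iota}{}'$, where conclusions of \<open>EqE\<close> and of \<open>BotE\<close> with
  non-vacuous discharge are atomic and those of \<open>BotE\<close> with vacuous discharge are prime.
\<close>

inductive deduction :: "('p \<Rightarrow> nat) \<Rightarrow> ('c, 'p) ded \<Rightarrow> bool" for ar :: "'p \<Rightarrow> nat" where
  Assume:
    "formula ar A \<Longrightarrow> deduction ar (Assume u A)"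
| ImpI:
    "\<lbrakk>deduction ar D; concl D = B; formula ar A\<rbrakk>
     \<Longrightarrow> deduction ar (Infer (ImpI u) (Imp A B) [D])"
| ImpE:
    "\<lbrakk>deduction ar D\<^sub>1; deduction ar D\<^sub>2; concl D\<^sub>1 = Imp A B; concl D\<^sub>2 = A\<rbrakk>
     \<Longrightarrow> deduction ar (Infer ImpE B [D\<^sub>1, D\<^sub>2])"
| BotE:
    "\<lbrakk>deduction ar D; concl D = Falsum; formula ar A; atomic A;
      (u, Neg A) \<notin> open_asms D \<longrightarrow> prime A\<rbrakk>
     \<Longrightarrow> deduction ar (Infer (BotE u) A [D])"
| ForallI:
    "\<lbrakk>deduction ar D; concl D = subst_fm x (Par a) A; a \<notin> params_fm (Forall x A);
      \<forall>B \<in> snd ` (open_asms D - {(u, Existent (Par a))}). a \<notin> params_fm B\<rbrakk>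
     \<Longrightarrow> deduction ar (Infer (ForallI u a) (Forall x A) [D])"
| ForallE:
    "\<lbrakk>deduction ar D\<^sub>1; deduction ar D\<^sub>2; concl D\<^sub>1 = Forall x A; concl D\<^sub>2 = Existent t;
      atomic_tm t; B = subst_fm x t A\<rbrakk>
     \<Longrightarrow> deduction ar (Infer ForallE B [D\<^sub>1, D\<^sub>2])"
| EqI:
    "\<lbrakk>deduction ar D\<^sub>1; deduction ar D\<^sub>2; concl D\<^sub>1 = Existent t; concl D\<^sub>2 = C;
      a \<notin> params_tm t; a \<notin> params_fm C;
      \<forall>B \<in> snd ` (open_asms D\<^sub>2 - {(u, Ident (Par a) t)}). a \<notin> params_fm B\<rbrakk>
     \<Longrightarrow> deduction ar (Infer (EqI u a) C [D\<^sub>1, D\<^sub>2])"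
| EqE:
    "\<lbrakk>deduction ar D\<^sub>1; deduction ar D\<^sub>2; concl D\<^sub>1 = Ident t\<^sub>1 t\<^sub>2; concl D\<^sub>2 = subst_fm x t\<^sub>1 A;
      B = subst_fm x t\<^sub>2 A; atomic B\<rbrakk>
     \<Longrightarrow> deduction ar (Infer EqE B [D\<^sub>1, D\<^sub>2])"
| AD_Pred:
    "\<lbrakk>deduction ar D; concl D = Pred P ts; t \<in> set ts\<rbrakk>
     \<Longrightarrow> deduction ar (Infer AD (Existent t) [D])"
| AD_Ident:
    "\<lbrakk>deduction ar D; concl D = Ident t\<^sub>1 t\<^sub>2; t \<in> {t\<^sub>1, t\<^sub>2}\<rbrakk>
     \<Longrightarrow> deduction ar (Infer AD (Existent t) [D])"
| IotaI:
    "\<lbrakk>deduction ar D; deduction ar D\<^sub>1; deduction ar D\<^sub>2;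
      concl D = Existent t; concl D\<^sub>1 = subst_fm x (Par a) F; concl D\<^sub>2 = Ident (Par a) t;
      atomic_tm t; a \<notin> params_tm (Iota x F); a \<notin> params_tm t;
      \<forall>B \<in> open_formulas (Infer (IotaI u a) (Ident (Iota x F) t) [D, D\<^sub>1, D\<^sub>2]). a \<notin> params_fm B\<rbrakk>
     \<Longrightarrow> deduction ar (Infer (IotaI u a) (Ident (Iota x F) t) [D, D\<^sub>1, D\<^sub>2])"
| IotaE1:
    "\<lbrakk>deduction ar D\<^sub>1; deduction ar D\<^sub>2; concl D\<^sub>1 = Ident (Iota x F) t; concl D\<^sub>2 = Ident u t;
      atomic_tm t; atomic_tm u; B = subst_fm x u F\<rbrakk>
     \<Longrightarrow> deduction ar (Infer IotaE1 B [D\<^sub>1, D\<^sub>2])"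
| IotaE2:
    "\<lbrakk>deduction ar D\<^sub>1; deduction ar D\<^sub>2; deduction ar D\<^sub>3;
      concl D\<^sub>1 = Ident (Iota x F) t; concl D\<^sub>2 = subst_fm x u F; concl D\<^sub>3 = Existent u;
      atomic_tm t; atomic_tm u\<rbrakk>
     \<Longrightarrow> deduction ar (Infer IotaE2 (Ident u t) [D\<^sub>1, D\<^sub>2, D\<^sub>3])"
| IotaE3:
    "\<lbrakk>deduction ar D; concl D = Ident (Iota x F) t\<rbrakk>
     \<Longrightarrow> deduction ar (Infer IotaE3 (Existent t) [D])"


section \<open>Formula occurrences\<close>

text \<open>
  A formula occurrence is the path to it from the root: \<open>q @ [i]\<close> is the \<open>i\<close>-th premise
  (counted from 0) of the inference whose conclusion is the occurrence \<open>q\<close>.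
\<close>

type_synonym occ = "nat list"

primrec prems :: "('c, 'p) ded \<Rightarrow> ('c, 'p) ded list" where
  "prems (Assume u A) = []"
| "prems (Infer r C ds) = ds"

primrec sub_at :: "occ \<Rightarrow> ('c, 'p) ded \<Rightarrow> ('c, 'p) ded option" where
  "sub_at [] D = Some D"
| "sub_at (i # p) D = (if i < length (prems D) then sub_at p (prems D ! i) else None)"

definition occs :: "('c, 'p) ded \<Rightarrow> occ set" where
  "occs D = {p. sub_at p D \<noteq> None}"

definition fm_at :: "('c, 'p) ded \<Rightarrow> occ \<Rightarrow> ('c, 'p) fm" where
  "fm_at D p = concl (the (sub_at p D))"

definition rule_at :: "('c, 'p) ded \<Rightarrow> occ \<Rightarrow> rule option" where
  "rule_at D p = (case sub_at p D of Some (Infer r C ds) \<Rightarrow> Some r | _ \<Rightarrow> None)"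

definition discharges_at :: "('c, 'p) ded \<Rightarrow> occ \<Rightarrow> nat \<Rightarrow> (nat \<times> ('c, 'p) fm) set" where
  "discharges_at D q i =
     (case sub_at q D of Some (Infer r C ds) \<Rightarrow> discharges r C ds i | _ \<Rightarrow> {})"

text \<open>
  The occurrence \<open>p\<close> is an assumption discharged by the inference with conclusion \<open>q\<close>, i.e. this is
  the first inference on the way down from \<open>p\<close> that discharges its class.
\<close>

definition discharged_by :: "('c, 'p) ded \<Rightarrow> occ \<Rightarrow> occ \<Rightarrow> bool" where
  "discharged_by D p q \<longleftrightarrow>
     (\<exists>v B i s. p = q @ i # s \<and> sub_at p D = Some (Assume v B) \<and>
        (v, B) \<in> discharges_at D q i \<and>
        (\<forall>s\<^sub>1 j s\<^sub>2. s = s\<^sub>1 @ j # s\<^sub>2 \<longrightarrow> (v, B) \<notin> discharges_at D (q @ i # s\<^sub>1) j))"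

definition is_EqI :: "('c, 'p) ded \<Rightarrow> occ \<Rightarrow> bool" where
  "is_EqI D q \<longleftrightarrow> (\<exists>u a. rule_at D q = Some (EqI u a))"

definition is_EqE :: "('c, 'p) ded \<Rightarrow> occ \<Rightarrow> bool" where
  "is_EqE D q \<longleftrightarrow> rule_at D q = Some EqE"

text \<open>$(\bot E_C)$ in the narrow sense, with non-vacuous discharge.\<close>

definition is_BotEC :: "('c, 'p) ded \<Rightarrow> occ \<Rightarrow> bool" where
  "is_BotEC D q \<longleftrightarrow>
     (\<exists>u C E. sub_at q D = Some (Infer (BotE u) C [E]) \<and> (u, Neg C) \<in> open_asms E)"

definition is_AD_or_IotaE3 :: "('c, 'p) ded \<Rightarrow> occ \<Rightarrow> bool" where
  "is_AD_or_IotaE3 D q \<longleftrightarrow> rule_at D q \<in> {Some AD, Some IotaE3}"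

text \<open>
  Every inference from $\iota xF = t$ to $\exists!t$ counts as \<open>IotaE3\<close>, even if it is labelled \<open>AD\<close>.
\<close>

definition is_IotaE3 :: "('c, 'p) ded \<Rightarrow> occ \<Rightarrow> bool" where
  "is_IotaE3 D q \<longleftrightarrow> is_AD_or_IotaE3 D q \<and>
     (\<exists>x F t. fm_at D (q @ [0]) = Ident (Iota x F) t \<and> fm_at D q = Existent t)"

definition is_IotaE :: "('c, 'p) ded \<Rightarrow> occ \<Rightarrow> bool" where
  "is_IotaE D q \<longleftrightarrow> rule_at D q \<in> {Some IotaE1, Some IotaE2} \<or> is_IotaE3 D q"

text \<open>
  All E-rules are elimination rules, including those for identity and $\bot$; as no introduction
  rule for $\rightarrow$, $\forall$ or $\iota$ matches the latter two, they matter only for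
  segments of length at least 2.
\<close>

definition is_elim :: "('c, 'p) ded \<Rightarrow> occ \<Rightarrow> bool" where
  "is_elim D q \<longleftrightarrow>
     rule_at D q \<in> {Some ImpE, Some ForallE, Some EqE} \<or> (\<exists>u. rule_at D q = Some (BotE u)) \<or>
     is_IotaE D q"

text \<open>\<open>intro_elim D p q\<close>: \<open>p\<close> is concluded by an introduction rule for the operator which the
  elimination rule with conclusion \<open>q\<close> eliminates.\<close>

definition intro_elim :: "('c, 'p) ded \<Rightarrow> occ \<Rightarrow> occ \<Rightarrow> bool" where
  "intro_elim D p q \<longleftrightarrow>
     (\<exists>u. rule_at D p = Some (ImpI u)) \<and> rule_at D q = Some ImpE \<or>
     (\<exists>u a. rule_at D p = Some (ForallI u a)) \<and> rule_at D q = Some ForallE \<or>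
     (\<exists>u a. rule_at D p = Some (IotaI u a)) \<and> is_IotaE D q"


section \<open>Segments\<close>

definition minor_EqI :: "('c, 'p) ded \<Rightarrow> occ \<Rightarrow> bool" where
  "minor_EqI D p \<longleftrightarrow> (\<exists>q. p = q @ [1] \<and> is_EqI D q)"

definition alpha_segment :: "('c, 'p) ded \<Rightarrow> occ list \<Rightarrow> bool" where
  "alpha_segment D ps \<longleftrightarrow> ps \<noteq> [] \<and> set ps \<subseteq> occs D \<and>
     \<not> is_EqI D (hd ps) \<and> \<not> minor_EqI D (last ps) \<and>
     (\<forall>i. Suc i < length ps \<longrightarrow> ps ! i = ps ! Suc i @ [1] \<and> is_EqI D (ps ! Suc i))"

text \<open>
  \<open>BotEC_step D p q\<close>: \<open>p\<close> is the minor premise of an application of \<open>ImpE\<close> whose major premise is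
  discharged by an application of $(\bot E_C)$ with conclusion \<open>q\<close>.
\<close>

definition BotEC_step :: "('c, 'p) ded \<Rightarrow> occ \<Rightarrow> occ \<Rightarrow> bool" where
  "BotEC_step D p q \<longleftrightarrow>
     (\<exists>r. p = r @ [1] \<and> rule_at D r = Some ImpE \<and> discharged_by D (r @ [0]) q \<and> is_BotEC D q)"

definition beta_segment :: "('c, 'p) ded \<Rightarrow> occ list \<Rightarrow> bool" where
  "beta_segment D ps \<longleftrightarrow> ps \<noteq> [] \<and> set ps \<subseteq> occs D \<and>
     \<not> is_BotEC D (hd ps) \<and> (\<nexists>q. BotEC_step D (last ps) q) \<and>
     (\<forall>i. Suc i < length ps \<longrightarrow> BotEC_step D (ps ! i) (ps ! Suc i))"


section \<open>Maximal segments and normal form\<close>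

definition maximal_elim :: "('c, 'p) ded \<Rightarrow> occ list \<Rightarrow> bool" where
  "maximal_elim D ps \<longleftrightarrow> alpha_segment D ps \<and>
     (\<exists>q. last ps = q @ [0] \<and> is_elim D q \<and> (length ps = 1 \<longrightarrow> intro_elim D (last ps) q))"

definition maximal_BotEC :: "('c, 'p) ded \<Rightarrow> occ list \<Rightarrow> bool" where
  "maximal_BotEC D ps \<longleftrightarrow> (alpha_segment D ps \<or> beta_segment D ps) \<and>
     is_BotEC D (last ps) \<and>
     (\<exists>q. last ps = q @ [0] \<and> (is_IotaE D q \<or> is_AD_or_IotaE3 D q))"

definition maximal_Eq_refl :: "('c, 'p) ded \<Rightarrow> occ list \<Rightarrow> bool" where
  "maximal_Eq_refl D ps \<longleftrightarrow> alpha_segment D ps \<and>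
     (\<exists>t. \<forall>p\<in>set ps. fm_at D p = Ident t t) \<and>
     (\<exists>p\<in>set ps. minor_EqI D p) \<and>
     (\<exists>q. last ps = q @ [0] \<and> is_AD_or_IotaE3 D q)"

definition maximal_Eq_discharged :: "('c, 'p) ded \<Rightarrow> occ list \<Rightarrow> bool" where
  "maximal_Eq_discharged D ps \<longleftrightarrow> alpha_segment D ps \<and>
     (\<exists>a t. (\<forall>p\<in>set ps. fm_at D p = Ident (Par a) t) \<and>
        (\<exists>q. is_EqI D q \<and> discharged_by D (hd ps) q) \<and>
        (\<exists>q. last ps = q @ [0] \<and> is_AD_or_IotaE3 D q \<and> fm_at D q = Existent t))"

definition maximal_Existent :: "('c, 'p) ded \<Rightarrow> occ list \<Rightarrow> bool" where
  "maximal_Existent D ps \<longleftrightarrow> alpha_segment D ps \<and>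
     (\<exists>t. (\<forall>p\<in>set ps. fm_at D p = Existent t) \<and>
        is_AD_or_IotaE3 D (hd ps) \<and> fm_at D (hd ps @ [0]) = Ident t t \<and>
        (\<exists>q. last ps = q @ [0] \<and> is_EqI D q \<and> fm_at D q = Ident t t))"

definition minor_EqE :: "('c, 'p) ded \<Rightarrow> occ \<Rightarrow> bool" where
  "minor_EqE D p \<longleftrightarrow> (\<exists>q. p = q @ [1] \<and> is_EqE D q)"

text \<open>
  The first and the last clause on \<open>\<sigma>s\<close> force at least two segments; the step clause makes
  each inner segment both a conclusion and a minor premise of \<open>EqE\<close>.
\<close>

definition EqE_segment :: "('c, 'p) ded \<Rightarrow> occ list list \<Rightarrow> bool" where
  "EqE_segment D \<sigma>s \<longleftrightarrow> \<sigma>s \<noteq> [] \<and> (\<forall>\<sigma>\<in>set \<sigma>s. alpha_segment D \<sigma>) \<and>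
     minor_EqE D (last (hd \<sigma>s)) \<and> \<not> is_EqE D (hd (hd \<sigma>s)) \<and>
     is_EqE D (hd (last \<sigma>s)) \<and> \<not> minor_EqE D (last (last \<sigma>s)) \<and>
     (\<forall>i. Suc i < length \<sigma>s \<longrightarrow>
        last (\<sigma>s ! i) = hd (\<sigma>s ! Suc i) @ [1] \<and> is_EqE D (hd (\<sigma>s ! Suc i)))"

definition maximal_EqE :: "('c, 'p) ded \<Rightarrow> occ list list \<Rightarrow> bool" where
  "maximal_EqE D \<sigma>s \<longleftrightarrow> EqE_segment D \<sigma>s \<and>
     ((\<exists>q. last (last \<sigma>s) = q @ [0] \<and> is_AD_or_IotaE3 D q) \<or>
      (\<forall>\<sigma>\<in>set \<sigma>s. \<forall>p\<in>set \<sigma>. \<exists>t. fm_at D p = Existent t))"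

definition normal_form :: "('c, 'p) ded \<Rightarrow> bool" where
  "normal_form D \<longleftrightarrow>
     (\<nexists>ps. maximal_elim D ps) \<and>
     (\<nexists>ps. maximal_BotEC D ps) \<and>
     (\<nexists>ps. maximal_Eq_refl D ps) \<and>
     (\<nexists>ps. maximal_Eq_discharged D ps) \<and>
     (\<nexists>ps. maximal_Existent D ps) \<and>
     (\<nexists>\<sigma>s. maximal_EqE D \<sigma>s)"

definition no_vacuous_EqE :: "('c, 'p) ded \<Rightarrow> bool" where
  "no_vacuous_EqE D \<longleftrightarrow> (\<nexists>q t. is_EqE D q \<and> fm_at D (q @ [0]) = Ident t t)"

end

theory Submission
  imports Defs "HOL-Library.Countable_Set"
begin

text \<open>
  Normal deductions are obtained by completeness rather than by reduction.  Suppose that \<open>A\<close> has no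
  deduction from \<open>\<Gamma>\<close> of a certain normal shape.  Then \<open>A\<close> can be decomposed as false in a context
  from which $\bot$ has no such deduction, and this context can be extended, one formula at a time,
  to a saturated chain of finite contexts.  The existing parameters, modulo provable identity, form
  a model of negative free logic with descriptions; every formula concluded by an elimination is true
  in it and every formula decomposed as false is false in it.  This contradicts the soundness of
  $\mathbf{CNF}^{\iota}{}'$ in this semantics.

  The truth lemma only needs deductions that are normal by construction: \<open>AD\<close> is applied to
  assumptions, to conclusions of eliminations and of \<open>IotaI\<close>, and \<open>EqI\<close> is never followed by an
  elimination or by \<open>AD\<close>.
\<close>

section \<open>Syntax\<close>

text \<open>Truth is squeezed between two notions instead: what ends in an elimination is true, what
  is decomposed as false is false. Cut is absorbed by soundness, which is applied to the given
  deduction. The main obstacle is \<open>EqI\<close>. It supplies the witnesses of saturation, but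
  its conclusion must not be a major premise or a premise of \<open>AD\<close> or
  \<open>BotE\<close>. Hence three strengths of derivability: \<open>neu\<close> for major premises,
  \<open>core\<close> where only a final \<open>EqI\<close> is forbidden, and
  \<open>nderives\<close>, which stacks \<open>EqI\<close> below \<open>core\<close>. As
  \<open>AD\<close> may not follow \<open>EqE\<close> or \<open>BotE\<close>, a derived identity
  need not yield the existence of its terms, and existence is carried along separately. A second
  obstacle is that \<open>BotE\<close> with an atomic but not prime conclusion needs a real
  discharge, which has to be manufactured when the refutation does not use the negated
  formula.\<close>

lemma subst_notin:
  fixes s :: "('c, 'p) tm" and A :: "('c, 'p) fm"
  shows "x \<notin> fv_tm s \<Longrightarrow> subst_tm x t s = s" and "x \<notin> fv_fm A \<Longrightarrow> subst_fm x t A = A"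
  by (induction s and A) (auto intro: map_idI)

lemma fv_subst:
  fixes s :: "('c, 'p) tm" and A :: "('c, 'p) fm"
  assumes "fv_tm t = {}"
  shows "fv_tm (subst_tm x t s) = fv_tm s - {x}" and "fv_fm (subst_fm x t A) = fv_fm A - {x}"
  using assms by (induction s and A) auto

lemma arity_subst:
  fixes s :: "('c, 'p) tm" and A :: "('c, 'p) fm"
  assumes "arity_tm ar t"
  shows "arity_tm ar s \<Longrightarrow> arity_tm ar (subst_tm x t s)"
    and "arity_fm ar A \<Longrightarrow> arity_fm ar (subst_fm x t A)"
  using assms by (induction s and A) (auto simp: list_all_iff)

lemma consts_subst:
  fixes s :: "('c, 'p) tm" and A :: "('c, 'p) fm"
  shows "set1_tm (subst_tm x t s) \<subseteq> set1_tm s \<union> set1_tm t"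
    and "set1_fm (subst_fm x t A) \<subseteq> set1_fm A \<union> set1_tm t"
proof (induction s and A)
  case (Pred P ts)
  then show ?case by simp blast
qed auto

lemma preds_subst:
  fixes s :: "('c, 'p) tm" and A :: "('c, 'p) fm"
  shows "set2_tm (subst_tm x t s) \<subseteq> set2_tm s \<union> set2_tm t"
    and "set2_fm (subst_fm x t A) \<subseteq> set2_fm A \<union> set2_tm t"
proof (induction s and A)
  case (Pred P ts)
  then show ?case by simp blast
qed auto

text \<open>Makes \<open>size\<close> a measure for the later inductions: the scope of a quantifier
  or description stays smaller than the whole after a parameter is put in.\<close>

lemma size_subst_Par:
  fixes s :: "('c, 'p) tm" and A :: "('c, 'p) fm"
  shows "size (subst_tm x (Par a) s) = size s" and "size (subst_fm x (Par a) A) = size A"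
proof (induction s and A)
  case (Pred P ts)
  then have "size_list size (map (subst_tm x (Par a)) ts) = size_list size ts"
    by (induction ts) auto
  then show ?case by simp
qed auto

lemma finite_params:
  fixes s :: "('c, 'p) tm" and A :: "('c, 'p) fm"
  shows "finite (params_tm s)" and "finite (params_fm A)"
  by (induction s and A) auto

lemma size_arg: "t \<in> set ts \<Longrightarrow> size t < size (Pred P ts)"
  by (simp add: size_list_estimation' less_Suc_eq_le)

lemma deduction_closed:
  "deduction ar D \<Longrightarrow> fv_fm (concl D) = {}"
proof (induction rule: deduction.induct)
  case (AD_Pred D P ts t)
  then show ?case by simp
next
  case (EqE D\<^sub>1 D\<^sub>2 t\<^sub>1 t\<^sub>2 x A B)
  then show ?case by (simp add: fv_subst)
next
  case (ForallE D\<^sub>1 D\<^sub>2 x A t B)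
  then show ?case by (simp add: fv_subst)
next
  case (ForallI D x a A u)
  then show ?case by (simp add: fv_subst)
next
  case (IotaI D D\<^sub>1 D\<^sub>2 t x a F u)
  then show ?case by (simp add: fv_subst)
next
  case (IotaE1 D\<^sub>1 D\<^sub>2 x F t u B)
  then show ?case by (simp add: fv_subst)
qed (auto simp: formula_def)

section \<open>Countability of the formulas over a countable signature\<close>

instance tm :: (countable, countable) countable
  by countable_datatype
instance fm :: (countable, countable) countable
  by countable_datatype

text \<open>The types \<open>'c\<close> and \<open>'p\<close> are arbitrary, so the formulas are
  exhibited as images, under a renaming of symbols, of formulas over \<open>nat\<close>, which form
  a countable type.\<close>

lemma countable_fms:
  assumes "countable C" "countable P"
  shows "countable {A :: ('c, 'p) fm. set1_fm A \<subseteq> C \<and> set2_fm A \<subseteq> P}"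
proof -
  obtain f :: "nat \<Rightarrow> 'c" where f: "C \<subseteq> range f"
    using assms(1) by (metis countable_empty empty_subsetI range_from_nat_into subset_refl)
  obtain g :: "nat \<Rightarrow> 'p" where g: "P \<subseteq> range g"
    using assms(2) by (metis countable_empty empty_subsetI range_from_nat_into subset_refl)
  have "A = map_fm f g (map_fm (inv f) (inv g) A)" if "set1_fm A \<subseteq> C" "set2_fm A \<subseteq> P" for A
    using that f g by (auto simp: fm.map_comp f_inv_into_f subset_iff intro!: fm.map_ident_strong[symmetric])
  then have "{A :: ('c, 'p) fm. set1_fm A \<subseteq> C \<and> set2_fm A \<subseteq> P} \<subseteq> range (map_fm f g)"
    by blast
  then show ?thesis by (rule countable_subset) simp
qed

section \<open>Semantics and soundness\<close>

text \<open>Negative free logic: a term may lack a denotation, an atomic formula with such a term is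
  false, and \<open>M\<close> may be empty. Parameters are read off \<open>e\<close>, free variables
  off \<open>v\<close>. The valuation comes last so that the recursion can map over the arguments of
  a predicate letter.\<close>

primrec den :: "'d set \<Rightarrow> ('c \<Rightarrow> 'd option) \<Rightarrow> ('p \<Rightarrow> 'd list \<Rightarrow> bool) \<Rightarrow> (nat \<Rightarrow> 'd option) \<Rightarrow>
      ('c, 'p) tm \<Rightarrow> (nat \<Rightarrow> 'd option) \<Rightarrow> 'd option"
  and sat :: "'d set \<Rightarrow> ('c \<Rightarrow> 'd option) \<Rightarrow> ('p \<Rightarrow> 'd list \<Rightarrow> bool) \<Rightarrow> (nat \<Rightarrow> 'd option) \<Rightarrow>
      ('c, 'p) fm \<Rightarrow> (nat \<Rightarrow> 'd option) \<Rightarrow> bool" where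
  "den M k r e (Par a) v = e a"
| "den M k r e (Const c) v = k c"
| "den M k r e (Var x) v = v x"
| "den M k r e (Iota x F) v =
     (if \<exists>!d. d \<in> M \<and> sat M k r e F (v(x \<mapsto> d))
      then Some (THE d. d \<in> M \<and> sat M k r e F (v(x \<mapsto> d))) else None)"
| "sat M k r e (Pred P ts) v =
     (\<exists>ds. map (\<lambda>f. f v) (map (den M k r e) ts) = map Some ds \<and> r P ds)"
| "sat M k r e (Existent s) v = (den M k r e s v \<noteq> None)"
| "sat M k r e (Ident s t) v = (\<exists>d. den M k r e s v = Some d \<and> den M k r e t v = Some d)"
| "sat M k r e Falsum v = False"
| "sat M k r e (Imp A B) v = (sat M k r e A v \<longrightarrow> sat M k r e B v)"
| "sat M k r e (Forall x A) v = (\<forall>d\<in>M. sat M k r e A (v(x \<mapsto> d)))"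

lemma den_sat_cong:
  fixes s :: "('c, 'p) tm" and A :: "('c, 'p) fm"
  shows "(\<And>a. a \<in> params_tm s \<Longrightarrow> e a = e' a) \<Longrightarrow> (\<And>x. x \<in> fv_tm s \<Longrightarrow> v x = v' x) \<Longrightarrow>
      den M k r e s v = den M k r e' s v'"
    and "(\<And>a. a \<in> params_fm A \<Longrightarrow> e a = e' a) \<Longrightarrow> (\<And>x. x \<in> fv_fm A \<Longrightarrow> v x = v' x) \<Longrightarrow>
      sat M k r e A v = sat M k r e' A v'"
proof (induction s and A arbitrary: v v' and v v')
  case (Iota x F)
  have "sat M k r e F (v(x \<mapsto> d)) = sat M k r e' F (v'(x \<mapsto> d))" for d
    by (rule Iota.IH) (use Iota.prems in auto)
  then show ?case by simp
next
  case (Pred P ts)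
  have "map (\<lambda>t. den M k r e t v) ts = map (\<lambda>t. den M k r e' t v') ts"
    by (rule map_cong[OF refl], rule Pred.IH) (use Pred.prems in auto)
  then show ?case by (simp only: sat.simps subst_fm.simps list.map_comp comp_def)
next
  case (Forall x A)
  have "sat M k r e A (v(x \<mapsto> d)) = sat M k r e' A (v'(x \<mapsto> d))" for d
    by (rule Forall.IH) (use Forall.prems in auto)
  then show ?case by simp
next
  case (Existent s)
  then have "den M k r e s v = den M k r e' s v'" by auto
  then show ?case by simp
next
  case (Ident s t)
  then have "den M k r e s v = den M k r e' s v'" "den M k r e t v = den M k r e' t v'" by auto
  then show ?case by simp
next
  case (Imp A B)
  then have "sat M k r e A v = sat M k r e' A v'" "sat M k r e B v = sat M k r e' B v'" by auto
  then show ?case by simp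
qed auto

lemma den_closed: "fv_tm t = {} \<Longrightarrow> den M k r e t v = den M k r e t v'"
  by (rule den_sat_cong) auto

lemma den_sat_subst:
  fixes s :: "('c, 'p) tm" and A :: "('c, 'p) fm"
  assumes t: "fv_tm t = {}"
  shows "den M k r e (subst_tm x t s) v = den M k r e s (v(x := den M k r e t v))"
    and "sat M k r e (subst_fm x t A) v = sat M k r e A (v(x := den M k r e t v))"
proof (induction s and A arbitrary: v and v)
  case (Iota y F)
  have "sat M k r e (subst_fm x t F) (v(y \<mapsto> d)) =
      sat M k r e F ((v(x := den M k r e t v))(y \<mapsto> d))" if "y \<noteq> x" for d
  proof -
    have "(v(y \<mapsto> d))(x := den M k r e t (v(y \<mapsto> d))) = (v(x := den M k r e t v))(y \<mapsto> d)"
      using that den_closed[OF t, of M k r e "v(y \<mapsto> d)" v] by (auto simp: fun_eq_iff)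
    then show ?thesis using Iota.IH[of "v(y \<mapsto> d)"] by (simp only:)
  qed
  then show ?case
    by (cases "y = x") (simp_all only: den.simps subst_tm.simps if_True if_False fun_upd_upd simp_thms)
next
  case (Forall y A)
  have "sat M k r e (subst_fm x t A) (v(y \<mapsto> d)) =
      sat M k r e A ((v(x := den M k r e t v))(y \<mapsto> d))" if "y \<noteq> x" for d
  proof -
    have "(v(y \<mapsto> d))(x := den M k r e t (v(y \<mapsto> d))) = (v(x := den M k r e t v))(y \<mapsto> d)"
      using that den_closed[OF t, of M k r e "v(y \<mapsto> d)" v] by (auto simp: fun_eq_iff)
    then show ?thesis using Forall.IH[of "v(y \<mapsto> d)"] by (simp only:)
  qed
  then show ?case
    by (cases "y = x") (simp_all only: sat.simps subst_fm.simps if_True if_False fun_upd_upd simp_thms)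
next
  case (Pred P ts)
  then have "map (\<lambda>u. den M k r e (subst_tm x t u) v) ts =
      map (\<lambda>u. den M k r e u (v(x := den M k r e t v))) ts" by (simp add: fun_upd_def)
  then show ?case by (simp only: sat.simps subst_fm.simps list.map_comp comp_def)
qed auto

lemma den_Iota_eq_Some:
  "den M k r e (Iota x F) v = Some d \<longleftrightarrow>
     d \<in> M \<and> sat M k r e F (v(x \<mapsto> d)) \<and> (\<forall>d'\<in>M. sat M k r e F (v(x \<mapsto> d')) \<longrightarrow> d' = d)"
  (is "?L \<longleftrightarrow> ?R")
proof
  assume ?L
  then have ex: "\<exists>!d. d \<in> M \<and> sat M k r e F (v(x \<mapsto> d))"
    and d: "d = (THE d. d \<in> M \<and> sat M k r e F (v(x \<mapsto> d)))"
    by (auto split: if_splits)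
  show ?R using theI'[OF ex] ex unfolding d[symmetric] by auto
next
  assume R: ?R
  then have ex: "\<exists>!d. d \<in> M \<and> sat M k r e F (v(x \<mapsto> d))" by auto
  moreover have "(THE d. d \<in> M \<and> sat M k r e F (v(x \<mapsto> d))) = d"
    using R by (intro the_equality) auto
  ultimately show ?L by simp
qed

lemma den_in_domain:
  assumes "ran k \<subseteq> M" "ran e \<subseteq> M" "fv_tm s = {}" "den M k r e s v = Some d"
  shows "d \<in> M"
proof (cases s)
  case (Iota x F)
  then show ?thesis using assms(4) den_Iota_eq_Some by metis
qed (use assms in \<open>auto intro: ranI\<close>)

lemma atomic_tm_closed: "atomic_tm t \<Longrightarrow> fv_tm t = {}"
  by (cases t) auto

text \<open>An open assumption of a premise is either still open below the inference or discharged
  by it; so in the soundness proof only the discharged formulas have to be checked.\<close>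

lemma open_formulas_prem:
  assumes "\<And>B. B \<in> open_formulas (Infer r C ds) \<Longrightarrow> Q B"
    and "\<And>l B. (l, B) \<in> discharges r C ds i \<Longrightarrow> Q B"
    and "ds ! i = D" "i < length ds" "B \<in> open_formulas D"
  shows "Q B"
  using assms unfolding open_formulas_def by (force simp: image_iff)

text \<open>\<open>e\<close> is arbitrary in the induction because a rule with a proper parameter is
  verified by letting that parameter denote a chosen object, which affects no formula without it.
  The conditions on \<open>ran k\<close> and \<open>ran e\<close> put every denotation into
  \<open>M\<close>.\<close>

lemma sound:
  fixes k :: "'c \<Rightarrow> 'd option" and D :: "('c, 'p) ded"
  assumes k: "ran k \<subseteq> M"
  shows "deduction ar D \<Longrightarrow> ran e \<subseteq> M \<Longrightarrow>
     (\<And>B. B \<in> open_formulas D \<Longrightarrow> sat M k r e B v) \<Longrightarrow> sat M k r e (concl D) v"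
proof (induction arbitrary: e rule: deduction.induct)
  case (Assume A u)
  then show ?case by (simp add: open_formulas_def)
next
  case (ImpI D B A u)
  show ?case
  proof (simp, intro impI)
    assume A: "sat M k r e A v"
    have "sat M k r e (concl D) v"
      by (rule ImpI.IH[OF ImpI.prems(1)],
          rule open_formulas_prem[where i=0 and Q="\<lambda>B. sat M k r e B v",
            OF ImpI.prems(2)]) (use A in auto)
    then show "sat M k r e B v" using ImpI.hyps by simp
  qed
next
  case (ImpE D1 D2 A B)
  have "sat M k r e (concl D1) v" "sat M k r e (concl D2) v"
    subgoal by (rule ImpE.IH(1)[OF ImpE.prems(1)],
        rule open_formulas_prem[where i=0 and Q="\<lambda>B. sat M k r e B v",
          OF ImpE.prems(2)]) auto
    subgoal by (rule ImpE.IH(2)[OF ImpE.prems(1)],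
        rule open_formulas_prem[where i=1 and Q="\<lambda>B. sat M k r e B v",
          OF ImpE.prems(2)]) auto
    done
  then show ?case using ImpE.hyps by simp
next
  case (BotE D A u)
  show ?case
  proof (simp, rule ccontr)
    assume A: "\<not> sat M k r e A v"
    have "sat M k r e (concl D) v"
      by (rule BotE.IH[OF BotE.prems(1)],
          rule open_formulas_prem[where i=0 and Q="\<lambda>B. sat M k r e B v",
            OF BotE.prems(2)]) (use A in auto)
    then show False using BotE.hyps by simp
  qed
next
  case (ForallI D x a A u)
  show ?case
  proof (simp, intro ballI)
    fix d assume d: "d \<in> M"
    let ?e = "e(a \<mapsto> d)"
    have "sat M k r ?e (concl D) v"
    proof (rule ForallI.IH)
      show "ran ?e \<subseteq> M" using d ForallI.prems(1) by (auto simp: ran_def)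
      fix B assume B: "B \<in> open_formulas D"
      show "sat M k r ?e B v"
      \<comment> \<open>Under \<open>?e\<close> this formula is true whatever its label; only the
        others need the freshness of \<open>a\<close>.\<close>
      proof (cases "B = Existent (Par a)")
        case False
        obtain l where "(l, B) \<in> open_asms D" using B by (auto simp: open_formulas_def)
        with False have l: "(l, B) \<in> open_asms D - {(u, Existent (Par a))}" by simp
        then have "B \<in> snd ` (open_asms D - {(u, Existent (Par a))})" by (metis imageI snd_conv)
        then have "a \<notin> params_fm B" by (rule bspec[OF ForallI.hyps(4)])
        moreover from l have "B \<in> open_formulas (Infer (ForallI u a) (Forall x A) [D])"
          unfolding open_formulas_def by (intro image_eqI[of _ _ "(l, B)"]) auto
        ultimately have "a \<notin> params_fm B" "B \<in> open_formulas (Infer (ForallI u a) (Forall x A) [D])"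
          by blast+
        then have *: "a \<notin> params_fm B" "sat M k r e B v" using ForallI.prems(2) by blast+
        have "sat M k r ?e B v = sat M k r e B v"
          by (rule den_sat_cong) (use *(1) in auto)
        then show ?thesis using *(2) by simp
      qed simp
    qed
    then have "sat M k r ?e A (v(x \<mapsto> d))"
      using ForallI.hyps by (simp add: den_sat_subst)
    moreover have "sat M k r ?e A (v(x \<mapsto> d)) = sat M k r e A (v(x \<mapsto> d))"
      by (rule den_sat_cong) (use ForallI.hyps in auto)
    ultimately show "sat M k r e A (v(x \<mapsto> d))" by simp
  qed
next
  case (ForallE D1 D2 x A t B)
  have 1: "sat M k r e (concl D1) v" "sat M k r e (concl D2) v"
    subgoal by (rule ForallE.IH(1)[OF ForallE.prems(1)],
        rule open_formulas_prem[where i=0 and Q="\<lambda>B. sat M k r e B v",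
          OF ForallE.prems(2)]) auto
    subgoal by (rule ForallE.IH(2)[OF ForallE.prems(1)],
        rule open_formulas_prem[where i=1 and Q="\<lambda>B. sat M k r e B v",
          OF ForallE.prems(2)]) auto
    done
  have t: "fv_tm t = {}" using ForallE.hyps by (simp add: atomic_tm_closed)
  obtain d where d: "den M k r e t v = Some d" using 1 ForallE.hyps by auto
  have "d \<in> M" by (rule den_in_domain[OF k ForallE.prems(1) t d])
  with d show ?case using 1 ForallE.hyps t by (simp add: den_sat_subst)
next
  case (EqI D1 D2 t C a u)
  have 1: "sat M k r e (concl D1) v"
    by (rule EqI.IH(1)[OF EqI.prems(1)],
        rule open_formulas_prem[where i=0 and Q="\<lambda>B. sat M k r e B v",
          OF EqI.prems(2)]) auto
  then obtain d where d: "den M k r e t v = Some d" using EqI.hyps by auto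
  have t: "fv_tm t = {}" using deduction_closed[OF EqI.hyps(1)] EqI.hyps by simp
  have dM: "d \<in> M" by (rule den_in_domain[OF k EqI.prems(1) t d])
  let ?e = "e(a \<mapsto> d)"
  have "den M k r ?e t v = den M k r e t v"
    by (rule den_sat_cong) (use EqI.hyps in auto)
  with d have d': "den M k r ?e t v = Some d" by simp
  have "sat M k r ?e (concl D2) v"
  proof (rule EqI.IH(2))
    show "ran ?e \<subseteq> M" using dM EqI.prems(1) by (auto simp: ran_def)
    fix B assume B: "B \<in> open_formulas D2"
    show "sat M k r ?e B v"
    proof (cases "B = Ident (Par a) t")
      case True
      then show ?thesis using d' by simp
    next
      case False
      obtain l where "(l, B) \<in> open_asms D2" using B by (auto simp: open_formulas_def)
      with False have l: "(l, B) \<in> open_asms D2 - {(u, Ident (Par a) t)}" by simp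
      then have "B \<in> snd ` (open_asms D2 - {(u, Ident (Par a) t)})" by (metis imageI snd_conv)
      then have "a \<notin> params_fm B" by (rule bspec[OF EqI.hyps(7)])
      moreover from l have "B \<in> open_formulas (Infer (EqI u a) C [D1, D2])"
        using EqI.hyps(3) unfolding open_formulas_def
        by (intro image_eqI[of _ _ "(l, B)"]) (simp_all add: lessThan_Suc)
      ultimately have "a \<notin> params_fm B" "B \<in> open_formulas (Infer (EqI u a) C [D1, D2])"
        by blast+
      then have *: "a \<notin> params_fm B" "sat M k r e B v" using EqI.prems(2) by blast+
      have "sat M k r ?e B v = sat M k r e B v"
        by (rule den_sat_cong) (use * in auto)
      then show ?thesis using * by simp
    qed
  qed
  moreover have "sat M k r ?e C v = sat M k r e C v"
    by (rule den_sat_cong) (use EqI.hyps in auto)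
  ultimately show ?case using EqI.hyps by simp
next
  case (EqE D1 D2 t1 t2 x A B)
  have 1: "sat M k r e (concl D1) v" "sat M k r e (concl D2) v"
    subgoal by (rule EqE.IH(1)[OF EqE.prems(1)],
        rule open_formulas_prem[where i=0 and Q="\<lambda>B. sat M k r e B v",
          OF EqE.prems(2)]) auto
    subgoal by (rule EqE.IH(2)[OF EqE.prems(1)],
        rule open_formulas_prem[where i=1 and Q="\<lambda>B. sat M k r e B v",
          OF EqE.prems(2)]) auto
    done
  have t: "fv_tm t1 = {}" "fv_tm t2 = {}" using deduction_closed[OF EqE.hyps(1)] EqE.hyps by auto
  then show ?case using 1 EqE.hyps by (auto simp: den_sat_subst)
next
  case (AD_Pred D P ts t)
  have 1: "sat M k r e (concl D) v"
    by (rule AD_Pred.IH[OF AD_Pred.prems(1)],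
        rule open_formulas_prem[where i=0 and Q="\<lambda>B. sat M k r e B v",
          OF AD_Pred.prems(2)]) auto
  then obtain ds where "map (\<lambda>t. den M k r e t v) ts = map Some ds"
    using AD_Pred.hyps by (auto simp: comp_def)
  then have "den M k r e t v \<in> set (map Some ds)"
    using AD_Pred.hyps by (metis image_eqI list.set_map)
  then show ?case by auto
next
  case (AD_Ident D t1 t2 t)
  have 1: "sat M k r e (concl D) v"
    by (rule AD_Ident.IH[OF AD_Ident.prems(1)],
        rule open_formulas_prem[where i=0 and Q="\<lambda>B. sat M k r e B v",
          OF AD_Ident.prems(2)]) auto
  then show ?case using AD_Ident.hyps by auto
next
  case (IotaI D D1 D2 t x a F u)
  let ?D = "Infer (IotaI u a) (Ident (Iota x F) t) [D, D1, D2]"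
  have "sat M k r e (concl D) v"
    by (rule IotaI.IH(1)[OF IotaI.prems(1)],
        rule open_formulas_prem[where i=0 and Q="\<lambda>B. sat M k r e B v",
          OF IotaI.prems(2)]) auto
  then obtain d where d: "den M k r e t v = Some d" using IotaI.hyps by auto
  have t: "fv_tm t = {}" using IotaI.hyps by (simp add: atomic_tm_closed)
  have dM: "d \<in> M" by (rule den_in_domain[OF k IotaI.prems(1) t d])
  \<comment> \<open>The two minor premises reinterpret \<open>a\<close> differently: by the
    denotation \<open>d\<close> of \<open>t\<close>, and by an arbitrary object satisfying
    \<open>F\<close>. Neither disturbs the assumptions that remain open.\<close>
  have upd: "sat M k r (e(a \<mapsto> d')) B v" if "B \<in> open_formulas ?D" for B d'
  proof -
    have "sat M k r (e(a \<mapsto> d')) B v = sat M k r e B v"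
      by (rule den_sat_cong) (use that IotaI.hyps in auto)
    then show ?thesis using IotaI.prems(2) that by blast
  qed
  have F: "sat M k r (e(a \<mapsto> d')) (subst_fm x (Par a) F) v = sat M k r e F (v(x \<mapsto> d'))" for d'
  proof -
    have "sat M k r (e(a \<mapsto> d')) F (v(x \<mapsto> d')) = sat M k r e F (v(x \<mapsto> d'))"
      by (rule den_sat_cong) (use IotaI.hyps in auto)
    then show ?thesis by (simp add: den_sat_subst)
  qed
  have tt: "den M k r (e(a \<mapsto> d')) t v = Some d" for d'
  proof -
    have "den M k r (e(a \<mapsto> d')) t v = den M k r e t v"
      by (rule den_sat_cong) (use IotaI.hyps in auto)
    then show ?thesis using d by simp
  qed
  have ran: "ran (e(a \<mapsto> d')) \<subseteq> M" if "d' \<in> M" for d'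
    using that IotaI.prems(1) by (auto simp: ran_def)
  have "sat M k r (e(a \<mapsto> d)) (concl D1) v"
  proof (rule IotaI.IH(2)[OF ran[OF dM]])
    fix B assume "B \<in> open_formulas D1"
    then obtain l where l: "(l, B) \<in> open_asms D1" by (auto simp: open_formulas_def)
    show "sat M k r (e(a \<mapsto> d)) B v"
    proof (cases "(l, B) \<in> open_asms ?D")
      case True
      then show ?thesis by (intro upd) (force simp: open_formulas_def)
    next
      case False
      then have "B = Ident (Par a) t" using l by (auto simp: lessThan_Suc)
      then show ?thesis using tt by simp
    qed
  qed
  then have s1: "sat M k r e F (v(x \<mapsto> d))" using IotaI.hyps F by simp
  have "d' = d" if d': "d' \<in> M" and s: "sat M k r e F (v(x \<mapsto> d'))" for d'
  proof -
    have "sat M k r (e(a \<mapsto> d')) (concl D2) v"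
    proof (rule IotaI.IH(3)[OF ran[OF d']])
      fix B assume "B \<in> open_formulas D2"
      then obtain l where l: "(l, B) \<in> open_asms D2" by (auto simp: open_formulas_def)
      show "sat M k r (e(a \<mapsto> d')) B v"
      proof (cases "(l, B) \<in> open_asms ?D")
        case True
        then show ?thesis by (intro upd) (force simp: open_formulas_def)
      next
        case False
        then have "B = subst_fm x (Par a) F \<or> B = Existent (Par a)"
          using l by (auto simp: lessThan_Suc)
        then show ?thesis using s F by auto
      qed
    qed
    then show ?thesis using IotaI.hyps tt by simp
  qed
  then have "den M k r e (Iota x F) v = Some d"
    by (intro den_Iota_eq_Some[THEN iffD2] conjI ballI impI dM s1)
  then show ?case using d by simp
next
  case (IotaE1 D1 D2 x F t u B)
  have 1: "sat M k r e (concl D1) v" "sat M k r e (concl D2) v"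
    subgoal by (rule IotaE1.IH(1)[OF IotaE1.prems(1)],
        rule open_formulas_prem[where i=0 and Q="\<lambda>B. sat M k r e B v",
          OF IotaE1.prems(2)]) auto
    subgoal by (rule IotaE1.IH(2)[OF IotaE1.prems(1)],
        rule open_formulas_prem[where i=1 and Q="\<lambda>B. sat M k r e B v",
          OF IotaE1.prems(2)]) auto
    done
  have u: "fv_tm u = {}" using IotaE1.hyps by (simp add: atomic_tm_closed)
  obtain d where "den M k r e (Iota x F) v = Some d" "den M k r e u v = Some d"
    using 1 IotaE1.hyps by (auto simp del: den.simps)
  then show ?case using IotaE1.hyps u den_Iota_eq_Some[of M k r e x F v d]
    by (simp add: den_sat_subst)
next
  case (IotaE2 D1 D2 D3 x F t u)
  have 1: "sat M k r e (concl D1) v" "sat M k r e (concl D2) v" "sat M k r e (concl D3) v"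
    subgoal by (rule IotaE2.IH(1)[OF IotaE2.prems(1)],
        rule open_formulas_prem[where i=0 and Q="\<lambda>B. sat M k r e B v",
          OF IotaE2.prems(2)]) auto
    subgoal by (rule IotaE2.IH(2)[OF IotaE2.prems(1)],
        rule open_formulas_prem[where i=1 and Q="\<lambda>B. sat M k r e B v",
          OF IotaE2.prems(2)]) auto
    subgoal by (rule IotaE2.IH(3)[OF IotaE2.prems(1)],
        rule open_formulas_prem[where i=2 and Q="\<lambda>B. sat M k r e B v",
          OF IotaE2.prems(2)]) auto
    done
  have u: "fv_tm u = {}" using IotaE2.hyps by (simp add: atomic_tm_closed)
  obtain d where d: "den M k r e u v = Some d" using 1 IotaE2.hyps by auto
  have dM: "d \<in> M" by (rule den_in_domain[OF k IotaE2.prems(1) u d])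
  obtain d' where d': "den M k r e (Iota x F) v = Some d'" "den M k r e t v = Some d'"
    using 1 IotaE2.hyps by (auto simp del: den.simps)
  have "sat M k r e F (v(x \<mapsto> d))" using 1 IotaE2.hyps u d by (simp add: den_sat_subst)
  then have "d = d'" using den_Iota_eq_Some[THEN iffD1, OF d'(1)] dM by blast
  then show ?case using d d' by simp
next
  case (IotaE3 D x F t)
  have 1: "sat M k r e (concl D) v"
    by (rule IotaE3.IH[OF IotaE3.prems(1)],
        rule open_formulas_prem[where i=0 and Q="\<lambda>B. sat M k r e B v",
          OF IotaE3.prems(2)]) auto
  then show ?case using IotaE3.hyps by auto
qed

section \<open>A local criterion for normal form\<close>

primrec root :: "('c, 'p) ded \<Rightarrow> rule option" where
  "root (Assume u A) = None"
| "root (Infer r C ds) = Some r"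

definition ends_EqI :: "('c, 'p) ded \<Rightarrow> bool" where
  "ends_EqI D \<longleftrightarrow> (\<exists>u a. root D = Some (EqI u a))"

definition neutral :: "('c, 'p) ded \<Rightarrow> bool" where
  "neutral D \<longleftrightarrow> root D \<in> {Some ImpE, Some ForallE, Some IotaE1, Some IotaE2} \<or>
     (\<exists>A. D = Assume 0 A)"

text \<open>
  Label 1 is reserved for the assumptions discharged by \<open>EqI\<close>.  Such an assumption $a = t$ is not
  \<open>neutral\<close>, so that \<open>AD\<close> may conclude $\exists!a$ from it, but not $\exists!t$.
\<close>

primrec normal_step :: "rule \<Rightarrow> ('c, 'p) fm \<Rightarrow> ('c, 'p) ded list \<Rightarrow> bool" where
  "normal_step (ImpI u) C ds \<longleftrightarrow> u = 0"
| "normal_step ImpE C ds \<longleftrightarrow> neutral (hd ds)"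
| "normal_step (BotE u) C ds \<longleftrightarrow> \<not> ends_EqI (hd ds)"
| "normal_step (ForallI u a) C ds \<longleftrightarrow> u = 0"
| "normal_step ForallE C ds \<longleftrightarrow> neutral (hd ds)"
| "normal_step (EqI u a) C ds \<longleftrightarrow> u = 1 \<and> \<not> ends_EqI (hd ds) \<and>
     (\<nexists>t E es. C = Ident t t \<and> hd ds = Infer AD E es \<and> concl (hd es) = Ident t t)"
| "normal_step EqE C ds \<longleftrightarrow> \<not> ends_EqI (hd ds) \<and> (\<nexists>t. concl (hd ds) = Ident t t) \<and> (\<nexists>t. C = Existent t)"
| "normal_step AD C ds \<longleftrightarrow> neutral (hd ds) \<or>
     ((\<exists>v B. hd ds = Assume v B) \<or> (\<exists>v b. root (hd ds) = Some (IotaI v b))) \<and>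
     (\<exists>s t. concl (hd ds) = Ident s t \<and> C \<noteq> Existent t)"
| "normal_step (IotaI u a) C ds \<longleftrightarrow> u = 0"
| "normal_step IotaE1 C ds \<longleftrightarrow> neutral (hd ds) \<or> root (hd ds) = Some EqE"
| "normal_step IotaE2 C ds \<longleftrightarrow> neutral (hd ds) \<or> root (hd ds) = Some EqE"
| "normal_step IotaE3 C ds \<longleftrightarrow> False"

primrec is_normal :: "('c, 'p) ded \<Rightarrow> bool" where
  "is_normal (Assume u A) \<longleftrightarrow> True"
| "is_normal (Infer r C ds) \<longleftrightarrow> ds \<noteq> [] \<and> normal_step r C ds \<and> (\<forall>b\<in>set (map is_normal ds). b)"

section \<open>From conditions on single inferences to the absence of maximal segments\<close>

lemma sub_at_append:
  "sub_at (p @ q) D = Option.bind (sub_at p D) (sub_at q)"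
  by (induction p arbitrary: D) auto

lemma is_normal_sub_at: "sub_at p D = Some E \<Longrightarrow> is_normal D \<Longrightarrow> is_normal E"
proof (induction p arbitrary: D)
  case (Cons i p)
  then obtain r C ds where D: "D = Infer r C ds" by (cases D) auto
  with Cons.prems have "i < length ds" "sub_at p (ds ! i) = Some E" "is_normal (ds ! i)"
    by (auto split: if_splits)
  then show ?case using Cons.IH by blast
qed simp

lemma rule_at_Some:
  "rule_at D q = Some r \<longleftrightarrow> (\<exists>C ds. sub_at q D = Some (Infer r C ds))"
  unfolding rule_at_def by (auto split: option.splits ded.splits)

lemma rule_at_root: "sub_at q D = Some E \<Longrightarrow> rule_at D q = root E"
  unfolding rule_at_def by (cases E) auto

lemma normal_step_at:
  assumes "is_normal D" "rule_at D q = Some r"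
  obtains d where "sub_at (q @ [0]) D = Some d" "is_normal d" "rule_at D (q @ [0]) = root d"
    "fm_at D (q @ [0]) = concl d" "\<exists>C ds. fm_at D q = C \<and> d = hd ds \<and> normal_step r C ds \<and> sub_at q D = Some (Infer r C ds)"
proof -
  obtain C ds where q: "sub_at q D = Some (Infer r C ds)" using assms(2) rule_at_Some by metis
  have n: "is_normal (Infer r C ds)" using is_normal_sub_at[OF q assms(1)] .
  then have ds: "ds \<noteq> []" by simp
  then have d: "sub_at (q @ [0]) D = Some (hd ds)" using q by (simp add: sub_at_append hd_conv_nth)
  with n ds q d show ?thesis
    by (intro that[of "hd ds"]) (auto simp: rule_at_root fm_at_def)
qed

lemma is_EqI_ends_EqI: "sub_at p D = Some d \<Longrightarrow> is_EqI D p = ends_EqI d"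
  by (simp add: is_EqI_def ends_EqI_def rule_at_root)

text \<open>Every member of a segment after the first is concluded by \<open>EqI\<close>. Forbidding
  \<open>EqI\<close> directly above an inference thus shrinks the segment to one occurrence, which
  is what makes a local criterion possible.\<close>

lemma alpha_segment_singleton:
  assumes "alpha_segment D ps" "\<not> is_EqI D (last ps)"
  shows "ps = [last ps]"
proof -
  have "\<not> Suc 0 < length ps"
  proof
    assume *: "Suc 0 < length ps"
    then have "Suc (length ps - 2) < length ps" "Suc (length ps - 2) = length ps - 1" by auto
    then have "is_EqI D (ps ! (length ps - 1))"
      using assms(1) unfolding alpha_segment_def by metis
    then show False using assms * by (simp add: last_conv_nth alpha_segment_def)
  qed
  then show ?thesis using assms(1) by (cases ps) (auto simp: alpha_segment_def)
qed

lemma neutral_not_ends_EqI: "neutral d \<Longrightarrow> \<not> ends_EqI d"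
  by (auto simp: neutral_def ends_EqI_def)

text \<open>\<open>IotaE3\<close> itself is banned: \<open>AD\<close> can draw the same conclusion,
  and then counts as \<open>IotaE3\<close>.\<close>

lemma is_normal_AD_IotaE3:
  assumes "is_normal D" "is_AD_or_IotaE3 D q"
  obtains d where "sub_at (q @ [0]) D = Some d" "\<not> ends_EqI d" "root d \<noteq> Some EqE"
    "\<nexists>u. root d = Some (BotE u)"
    "neutral d \<or> (\<exists>s t. concl d = Ident s t \<and> fm_at D q \<noteq> Existent t)"
proof -
  have r: "rule_at D q = Some AD \<or> rule_at D q = Some IotaE3"
    using assms(2) by (auto simp: is_AD_or_IotaE3_def)
  then obtain r where r: "rule_at D q = Some r" "r = AD \<or> r = IotaE3" by auto
  obtain d where "sub_at (q @ [0]) D = Some d"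
    "\<exists>C ds. fm_at D q = C \<and> d = hd ds \<and> normal_step r C ds"
    using normal_step_at[OF assms(1) r(1)] by metis
  with r(2) show ?thesis
    by (intro that[of d]) (auto simp: neutral_def ends_EqI_def)
qed

lemma is_normal_normal_form:
  assumes is_normal: "is_normal D"
  shows "normal_form D" and "no_vacuous_EqE D"
proof -
  have elim: "\<not> maximal_elim D ps" for ps
  proof
    assume m: "maximal_elim D ps"
    then obtain q where a: "alpha_segment D ps" and q: "last ps = q @ [0]" and e: "is_elim D q"
      and ie: "length ps = 1 \<longrightarrow> intro_elim D (last ps) q"
      unfolding maximal_elim_def by blast
      obtain r where r: "rule_at D q = Some r"
      using e by (auto simp: is_elim_def is_IotaE_def is_IotaE3_def is_AD_or_IotaE3_def)
    obtain d where d: "sub_at (q @ [0]) D = Some d" "rule_at D (q @ [0]) = root d"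
      "fm_at D (q @ [0]) = concl d" and s: "\<exists>ds. d = hd ds \<and> normal_step r (fm_at D q) ds"
      using normal_step_at[OF is_normal r] by metis
    have "\<not> ends_EqI d"
      using s e r
      by (auto simp: is_elim_def is_IotaE_def is_IotaE3_def is_AD_or_IotaE3_def neutral_not_ends_EqI)
        (auto simp: ends_EqI_def)
    then have "\<not> is_EqI D (last ps)" using d q is_EqI_ends_EqI by metis
    \<comment> \<open>With length 1 the premise would have to come from a matching introduction.
      Major premises are neutral or end in \<open>EqE\<close>, and an \<open>AD\<close> after
      \<open>IotaI\<close> only infers the existence of the description, which does not count as
      \<open>IotaE3\<close>.\<close>
    then have "intro_elim D (q @ [0]) q" using alpha_segment_singleton[OF a] ie q by (metis One_nat_def length_Cons list.size(3))
    then show False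
      using s r d(2,3)
      by (auto simp: intro_elim_def is_IotaE_def is_IotaE3_def is_AD_or_IotaE3_def neutral_def)
  qed
  have bot: "\<not> maximal_BotEC D ps" for ps
  proof
    assume m: "maximal_BotEC D ps"
    then obtain q where a: "alpha_segment D ps \<or> beta_segment D ps" and q: "last ps = q @ [0]"
      and b: "is_BotEC D (q @ [0])" and e: "is_IotaE D q \<or> is_AD_or_IotaE3 D q"
      unfolding maximal_BotEC_def by metis
    obtain r where r: "rule_at D q = Some r"
      using e by (auto simp: is_IotaE_def is_IotaE3_def is_AD_or_IotaE3_def)
    obtain d where d: "sub_at (q @ [0]) D = Some d" "rule_at D (q @ [0]) = root d"
      and s: "\<exists>ds. d = hd ds \<and> normal_step r (fm_at D q) ds"
      using normal_step_at[OF is_normal r] by metis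
    have "\<exists>u. root d = Some (BotE u)" using b d(1) unfolding is_BotEC_def by auto
    then show False using s e r
      by (auto simp: is_IotaE_def is_IotaE3_def is_AD_or_IotaE3_def neutral_def)
  qed
  have single: "ps = [q @ [0]] \<and> (\<exists>d. sub_at (q @ [0]) D = Some d \<and> \<not> ends_EqI d \<and> root d \<noteq> Some EqE \<and>
      (neutral d \<or> (\<exists>s t. concl d = Ident s t \<and> fm_at D q \<noteq> Existent t)))"
    if "alpha_segment D ps" "last ps = q @ [0]" "is_AD_or_IotaE3 D q" for ps q
  proof -
    from is_normal_AD_IotaE3[OF is_normal that(3)] obtain d where "sub_at (q @ [0]) D = Some d" "\<not> ends_EqI d" "root d \<noteq> Some EqE"
      "neutral d \<or> (\<exists>s t. concl d = Ident s t \<and> fm_at D q \<noteq> Existent t)" by metis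
    then show ?thesis using alpha_segment_singleton that is_EqI_ends_EqI by metis
  qed
  have refl: "\<not> maximal_Eq_refl D ps" for ps
  proof
    assume m: "maximal_Eq_refl D ps"
    then obtain q p where a: "alpha_segment D ps" and q: "last ps = q @ [0]" "is_AD_or_IotaE3 D q"
      and p: "p \<in> set ps" "minor_EqI D p"
      unfolding maximal_Eq_refl_def by blast
    have "p = last ps" using single[OF a q] p by auto
    then show False using p a by (simp add: alpha_segment_def)
  qed
  \<comment> \<open>The labels decide this case: an assumption discharged by \<open>EqI\<close> has
    label 1, but inferring the existence of its right-hand side takes a neutral premise, hence label
    0.\<close>
  have dis: "\<not> maximal_Eq_discharged D ps" for ps
  proof
    assume m: "maximal_Eq_discharged D ps"
    then obtain q a t q' where a: "alpha_segment D ps" and q: "last ps = q @ [0]" "is_AD_or_IotaE3 D q"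
      and t: "fm_at D q = Existent t" and f: "\<forall>p\<in>set ps. fm_at D p = Ident (Par a) t"
      and q': "is_EqI D q'" "discharged_by D (hd ps) q'"
      unfolding maximal_Eq_discharged_def by blast
    obtain d where d: "sub_at (q @ [0]) D = Some d"
      "neutral d \<or> (\<exists>s t. concl d = Ident s t \<and> fm_at D q \<noteq> Existent t)"
      and ps: "ps = [q @ [0]]" using single[OF a q] by blast
    have "concl d = Ident (Par a) t" using f ps d(1) by (simp add: fm_at_def)
    then have n: "neutral d" using d(2) t by auto
    obtain v B i where v: "sub_at (q @ [0]) D = Some (Assume v B)" "(v, B) \<in> discharges_at D q' i"
      using q'(2) ps unfolding discharged_by_def by auto
    have "v = 0" using n v(1) d(1) by (auto simp: neutral_def)
    moreover obtain u b where "rule_at D q' = Some (EqI u b)" using q'(1) by (auto simp: is_EqI_def)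
    then obtain C ds where qd: "sub_at q' D = Some (Infer (EqI u b) C ds)" using rule_at_Some by metis
    then have "u = 1" using is_normal_sub_at[OF _ is_normal] by fastforce
    then have "v = 1" using v(2) qd by (auto simp: discharges_at_def)
    ultimately show False by simp
  qed
  have ex: "\<not> maximal_Existent D ps" for ps
  proof
    assume m: "maximal_Existent D ps"
    then obtain t q where a: "alpha_segment D ps" and q: "last ps = q @ [0]" and e: "is_EqI D q"
      and ad: "is_AD_or_IotaE3 D (hd ps)" "fm_at D (hd ps @ [0]) = Ident t t"
      and c: "fm_at D q = Ident t t"
      unfolding maximal_Existent_def by blast
      obtain u b where r: "rule_at D q = Some (EqI u b)" using e by (auto simp: is_EqI_def)
    obtain d where d: "sub_at (q @ [0]) D = Some d" "rule_at D (q @ [0]) = root d" "is_normal d"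
      and s: "\<exists>ds. d = hd ds \<and> normal_step (EqI u b) (fm_at D q) ds"
      using normal_step_at[OF is_normal r] by metis
    have "\<not> ends_EqI d" using s by auto
    then have ps: "ps = [q @ [0]]" using alpha_segment_singleton[OF a] d q is_EqI_ends_EqI by metis
    then have "root d = Some AD \<or> root d = Some IotaE3"
      using ad d(2) by (auto simp: is_AD_or_IotaE3_def)
    then obtain E es where dd: "d = Infer AD E es" "es \<noteq> []" using d(3) by (cases d) auto
    then have "fm_at D (q @ [0, 0]) = concl (hd es)"
      using d(1) sub_at_append[of "q @ [0]" "[0]" D] by (simp add: fm_at_def hd_conv_nth)
    then have "concl (hd es) = Ident t t" using ad(2) ps by simp
    moreover obtain ds where "hd ds = Infer AD E es" "normal_step (EqI u b) (Ident t t) ds"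
      using s c dd(1) by metis
    ultimately show False by auto
  qed
  \<comment> \<open>An \<open>AD\<close> below the last segment makes it a single occurrence, which
    would be a premise of \<open>AD\<close> concluded by \<open>EqE\<close>. The other alternative
    fails since \<open>EqE\<close> never concludes an existence formula.\<close>
  have eqe: "\<not> maximal_EqE D \<sigma>s" for \<sigma>s
  proof
    assume m: "maximal_EqE D \<sigma>s"
    let ?\<sigma> = "last \<sigma>s"
    have "\<sigma>s \<noteq> []" and a: "alpha_segment D ?\<sigma>" and h: "is_EqE D (hd ?\<sigma>)"
      using m by (auto simp: maximal_EqE_def EqE_segment_def)
    have r: "rule_at D (hd ?\<sigma>) = Some EqE" using h by (simp add: is_EqE_def)
    consider q where "last ?\<sigma> = q @ [0]" "is_AD_or_IotaE3 D q"
      | t where "fm_at D (hd ?\<sigma>) = Existent t"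
      using m a \<open>\<sigma>s \<noteq> []\<close> unfolding maximal_EqE_def alpha_segment_def
      by (metis hd_in_set last_in_set)
    then show False
    proof cases
      case 1
      then obtain d where "?\<sigma> = [q @ [0]]" "sub_at (q @ [0]) D = Some d" "root d \<noteq> Some EqE"
        using single[OF a] by blast
      then show False using r rule_at_root by (metis list.sel(1))
    next
      case 2
      then show False using normal_step_at[OF is_normal r] by (metis normal_step.simps(7))
    qed
  qed
  show "normal_form D"
    using elim bot refl dis ex eqe unfolding normal_form_def by blast
  show "no_vacuous_EqE D"
    unfolding no_vacuous_EqE_def is_EqE_def
    using normal_step_at[OF is_normal] by (metis normal_step.simps(7))
qed

section \<open>Normal derivability\<close>

definition params_ctx :: "(nat \<times> ('c, 'p) fm) set \<Rightarrow> nat set" where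
  "params_ctx \<Gamma> = (\<Union>(u, B)\<in>\<Gamma>. params_fm B)"

lemma finite_params_ctx: "finite \<Gamma> \<Longrightarrow> finite (params_ctx \<Gamma>)"
  by (auto simp: params_ctx_def finite_params)

lemma ex_fresh: "finite (X :: nat set) \<Longrightarrow> \<exists>a. a \<notin> X"
  by (rule ex_new_if_finite) simp

lemma open_params_ctx:
  "S \<subseteq> \<Gamma> \<Longrightarrow> a \<notin> params_ctx \<Gamma> \<Longrightarrow> \<forall>B \<in> snd ` S. a \<notin> params_fm B"
  by (force simp: params_ctx_def)

context
  fixes ar :: "'p \<Rightarrow> nat"
begin

text \<open>\<open>R\<close> restricts the last inference, and thereby records which positions in a
  larger deduction the witness may fill.\<close>

definition has_ded :: "(('c, 'p) ded \<Rightarrow> bool) \<Rightarrow> (nat \<times> ('c, 'p) fm) set \<Rightarrow> ('c, 'p) fm \<Rightarrow> bool" where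
  "has_ded R \<Gamma> A \<longleftrightarrow> (\<exists>D. deduction ar D \<and> is_normal D \<and> concl D = A \<and> open_asms D \<subseteq> \<Gamma> \<and> R D)"

abbreviation "normal \<equiv> has_ded (\<lambda>D. True)"
abbreviation "core \<equiv> has_ded (\<lambda>D. \<not> ends_EqI D)"
abbreviation "neu \<equiv> has_ded neutral"

lemma has_ded_mono: "has_ded R \<Gamma> A \<Longrightarrow> \<Gamma> \<subseteq> \<Delta> \<Longrightarrow> (\<And>D. R D \<Longrightarrow> S D) \<Longrightarrow> has_ded S \<Delta> A"
  unfolding has_ded_def by blast

lemma neu_core: "neu \<Gamma> A \<Longrightarrow> core \<Gamma> A"
  by (erule has_ded_mono) (auto simp: neutral_not_ends_EqI)

lemma core_normal: "core \<Gamma> A \<Longrightarrow> normal \<Gamma> A"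
  by (erule has_ded_mono) auto

lemma has_ded_closed: "has_ded R \<Gamma> A \<Longrightarrow> fv_fm A = {}"
  unfolding has_ded_def using deduction_closed by blast

section \<open>Closure of normal derivability under the rules\<close>

lemma core_Assume: "(u, A) \<in> \<Gamma> \<Longrightarrow> formula ar A \<Longrightarrow> core \<Gamma> A"
  unfolding has_ded_def by (rule exI[of _ "Assume u A"]) (auto simp: ends_EqI_def intro: deduction.Assume)

lemma neu_Assume: "(0, A) \<in> \<Gamma> \<Longrightarrow> formula ar A \<Longrightarrow> neu \<Gamma> A"
  unfolding has_ded_def by (rule exI[of _ "Assume 0 A"]) (auto simp: neutral_def intro: deduction.Assume)

lemma core_ImpI:
  assumes "normal (insert (0, A) \<Gamma>) B" "formula ar A"
  shows "core \<Gamma> (Imp A B)"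
proof -
  obtain D where D: "deduction ar D" "is_normal D" "concl D = B" "open_asms D \<subseteq> insert (0, A) \<Gamma>"
    using assms(1) unfolding has_ded_def by blast
  have "deduction ar (Infer (ImpI 0) (Imp A B) [D])" using D assms by (intro deduction.ImpI) auto
  then show ?thesis unfolding has_ded_def
    by (intro exI[of _ "Infer (ImpI 0) (Imp A B) [D]"]) (use D in \<open>auto simp: ends_EqI_def\<close>)
qed

lemma neu_ImpE:
  assumes "neu \<Gamma> (Imp A B)" "normal \<Gamma> A"
  shows "neu \<Gamma> B"
proof -
  obtain D E where D: "deduction ar D" "is_normal D" "concl D = Imp A B" "open_asms D \<subseteq> \<Gamma>" "neutral D"
    and E: "deduction ar E" "is_normal E" "concl E = A" "open_asms E \<subseteq> \<Gamma>"
    using assms unfolding has_ded_def by blast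
  have "deduction ar (Infer ImpE B [D, E])" using D E by (intro deduction.ImpE) auto
  then show ?thesis unfolding has_ded_def
    by (intro exI[of _ "Infer ImpE B [D, E]"])
      (use D E in \<open>auto simp: neutral_def[of "Infer _ _ _"] lessThan_Suc\<close>)
qed

lemma core_ForallI:
  assumes "normal (insert (0, Existent (Par a)) \<Gamma>) (subst_fm x (Par a) A)"
    "a \<notin> params_ctx \<Gamma>" "a \<notin> params_fm A"
  shows "core \<Gamma> (Forall x A)"
proof -
  obtain D where D: "deduction ar D" "is_normal D" "concl D = subst_fm x (Par a) A"
    "open_asms D \<subseteq> insert (0, Existent (Par a)) \<Gamma>"
    using assms(1) unfolding has_ded_def by blast
  have o: "open_asms D - {(0, Existent (Par a))} \<subseteq> \<Gamma>" using D by blast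
  have "deduction ar (Infer (ForallI 0 a) (Forall x A) [D])"
    using D assms open_params_ctx[OF o] by (intro deduction.ForallI) auto
  then show ?thesis unfolding has_ded_def
    by (intro exI[of _ "Infer (ForallI 0 a) (Forall x A) [D]"]) (use D o in \<open>auto simp: ends_EqI_def\<close>)
qed

lemma neu_ForallE:
  assumes "neu \<Gamma> (Forall x A)" "normal \<Gamma> (Existent t)" "atomic_tm t"
  shows "neu \<Gamma> (subst_fm x t A)"
proof -
  obtain D E where D: "deduction ar D" "is_normal D" "concl D = Forall x A" "open_asms D \<subseteq> \<Gamma>" "neutral D"
    and E: "deduction ar E" "is_normal E" "concl E = Existent t" "open_asms E \<subseteq> \<Gamma>"
    using assms(1,2) unfolding has_ded_def by blast
  let ?D = "Infer ForallE (subst_fm x t A) [D, E]"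
  have "deduction ar ?D" using D E assms(3) by (intro deduction.ForallE) auto
  then show ?thesis unfolding has_ded_def
    by (intro exI[of _ ?D]) (use D E in \<open>auto simp: neutral_def[of "Infer _ _ _"] lessThan_Suc\<close>)
qed

text \<open>The last inference is kept in the conclusion because an identity obtained in this way,
  though not neutral, may be the major premise of \<open>IotaE1\<close> and
  \<open>IotaE2\<close>.\<close>

lemma has_ded_EqE:
  assumes "core \<Gamma> (Ident s t)" "normal \<Gamma> (subst_fm x s A)" "s \<noteq> t"
    "atomic (subst_fm x t A)" "\<nexists>u. subst_fm x t A = Existent u"
  shows "has_ded (\<lambda>D. root D = Some EqE) \<Gamma> (subst_fm x t A)"
proof -
  obtain D E where D: "deduction ar D" "is_normal D" "concl D = Ident s t" "open_asms D \<subseteq> \<Gamma>" "\<not> ends_EqI D"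
    and E: "deduction ar E" "is_normal E" "concl E = subst_fm x s A" "open_asms E \<subseteq> \<Gamma>"
    using assms(1,2) unfolding has_ded_def by blast
  let ?D = "Infer EqE (subst_fm x t A) [D, E]"
  have "deduction ar ?D" using D E assms(4) by (intro deduction.EqE) auto
  then show ?thesis unfolding has_ded_def
    by (intro exI[of _ ?D]) (use D E assms(3,5) in \<open>auto simp: lessThan_Suc\<close>)
qed

lemma core_AD_Pred:
  assumes "neu \<Gamma> (Pred P ts)" "t \<in> set ts"
  shows "core \<Gamma> (Existent t)"
proof -
  obtain D where D: "deduction ar D" "is_normal D" "concl D = Pred P ts" "open_asms D \<subseteq> \<Gamma>" "neutral D"
    using assms(1) unfolding has_ded_def by blast
  have "deduction ar (Infer AD (Existent t) [D])" using D assms(2) by (intro deduction.AD_Pred) auto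
  then show ?thesis unfolding has_ded_def
    by (intro exI[of _ "Infer AD (Existent t) [D]"]) (use D in \<open>auto simp: ends_EqI_def\<close>)
qed

lemma core_AD_Ident:
  assumes "neu \<Gamma> (Ident s1 s2)" "t \<in> {s1, s2}"
  shows "core \<Gamma> (Existent t)"
proof -
  obtain D where D: "deduction ar D" "is_normal D" "concl D = Ident s1 s2" "open_asms D \<subseteq> \<Gamma>" "neutral D"
    using assms(1) unfolding has_ded_def by blast
  have "deduction ar (Infer AD (Existent t) [D])" by (rule deduction.AD_Ident[OF D(1,3) assms(2)])
  then show ?thesis unfolding has_ded_def
    by (intro exI[of _ "Infer AD (Existent t) [D]"]) (use D in \<open>auto simp: ends_EqI_def\<close>)
qed

text \<open>Meant for label 1, where the assumption is not neutral: only the existence of the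
  left-hand side may be inferred, and \<open>s \<noteq> t\<close> keeps it apart from the right-hand
  side.\<close>

lemma core_AD_Assume:
  assumes "(u, Ident s t) \<in> \<Gamma>" "formula ar (Ident s t)" "s \<noteq> t"
  shows "core \<Gamma> (Existent s)"
proof -
  let ?D = "Infer AD (Existent s) [Assume u (Ident s t)]"
  have "deduction ar ?D"
    by (rule deduction.AD_Ident[OF deduction.Assume[OF assms(2)]]) auto
  then show ?thesis unfolding has_ded_def
    by (intro exI[of _ ?D]) (use assms in \<open>auto simp: ends_EqI_def\<close>)
qed

lemma core_IotaI:
  assumes "normal \<Gamma> (Existent t)" "atomic_tm t"
    "normal (insert (0, Ident (Par b) t) \<Gamma>) (subst_fm x (Par b) F)"
    "normal (insert (0, subst_fm x (Par b) F) (insert (0, Existent (Par b)) \<Gamma>)) (Ident (Par b) t)"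
    "b \<notin> params_ctx \<Gamma>" "b \<notin> params_fm F" "b \<notin> params_tm t"
  shows "core \<Gamma> (Ident (Iota x F) t)" and "core \<Gamma> (Existent (Iota x F))"
proof -
  obtain D D1 D2 where D: "deduction ar D" "is_normal D" "concl D = Existent t" "open_asms D \<subseteq> \<Gamma>"
    and D1: "deduction ar D1" "is_normal D1" "concl D1 = subst_fm x (Par b) F"
      "open_asms D1 \<subseteq> insert (0, Ident (Par b) t) \<Gamma>"
    and D2: "deduction ar D2" "is_normal D2" "concl D2 = Ident (Par b) t"
      "open_asms D2 \<subseteq> insert (0, subst_fm x (Par b) F) (insert (0, Existent (Par b)) \<Gamma>)"
    using assms(1,3,4) unfolding has_ded_def by blast
  let ?E = "Infer (IotaI 0 b) (Ident (Iota x F) t) [D, D1, D2]"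
  have o: "open_asms ?E \<subseteq> \<Gamma>" using D(4) D1(4) D2(4) by (auto simp: lessThan_Suc)
  have d: "deduction ar ?E"
    using D D1 D2 assms open_params_ctx[OF o] by (intro deduction.IotaI) (auto simp: open_formulas_def)
  have n: "is_normal ?E" using D D1 D2 by simp
  show "core \<Gamma> (Ident (Iota x F) t)" unfolding has_ded_def
    by (intro exI[of _ ?E]) (use d n o in \<open>auto simp: ends_EqI_def\<close>)
  let ?F = "Infer AD (Existent (Iota x F)) [?E]"
  have "deduction ar ?F" by (rule deduction.AD_Ident[OF d]) auto
  moreover have "open_asms (Infer AD C [G]) = open_asms G" for C and G :: "('c, 'p) ded"
    by (simp add: lessThan_Suc)
  \<comment> \<open>The atomic \<open>t\<close> differs from the description, so this
    \<open>AD\<close> is not a disguised \<open>IotaE3\<close>.\<close>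
  moreover have "is_normal ?F" using n assms(2) by auto
  ultimately show "core \<Gamma> (Existent (Iota x F))" unfolding has_ded_def
    by (intro exI[of _ ?F]) (use o in \<open>auto simp: ends_EqI_def\<close>)
qed

lemma neu_IotaE1:
  assumes "has_ded (\<lambda>D. neutral D \<or> root D = Some EqE) \<Gamma> (Ident (Iota x F) t)" "normal \<Gamma> (Ident u t)"
    "atomic_tm t" "atomic_tm u"
  shows "neu \<Gamma> (subst_fm x u F)"
proof -
  obtain D E where D: "deduction ar D" "is_normal D" "concl D = Ident (Iota x F) t" "open_asms D \<subseteq> \<Gamma>"
      "neutral D \<or> root D = Some EqE"
    and E: "deduction ar E" "is_normal E" "concl E = Ident u t" "open_asms E \<subseteq> \<Gamma>"
    using assms(1,2) unfolding has_ded_def by blast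
  let ?D = "Infer IotaE1 (subst_fm x u F) [D, E]"
  have "deduction ar ?D" by (rule deduction.IotaE1[OF D(1) E(1) D(3) E(3)]) (use assms in auto)
  then show ?thesis unfolding has_ded_def
    by (intro exI[of _ ?D]) (use D E in \<open>auto simp: neutral_def[of "Infer _ _ _"] lessThan_Suc\<close>)
qed

lemma neu_IotaE2:
  assumes "has_ded (\<lambda>D. neutral D \<or> root D = Some EqE) \<Gamma> (Ident (Iota x F) t)"
    "normal \<Gamma> (subst_fm x u F)" "normal \<Gamma> (Existent u)" "atomic_tm t" "atomic_tm u"
  shows "neu \<Gamma> (Ident u t)"
proof -
  obtain D E G where D: "deduction ar D" "is_normal D" "concl D = Ident (Iota x F) t" "open_asms D \<subseteq> \<Gamma>"
      "neutral D \<or> root D = Some EqE"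
    and E: "deduction ar E" "is_normal E" "concl E = subst_fm x u F" "open_asms E \<subseteq> \<Gamma>"
    and G: "deduction ar G" "is_normal G" "concl G = Existent u" "open_asms G \<subseteq> \<Gamma>"
    using assms(1-3) unfolding has_ded_def by blast
  let ?D = "Infer IotaE2 (Ident u t) [D, E, G]"
  have "deduction ar ?D" by (rule deduction.IotaE2[OF D(1) E(1) G(1) D(3) E(3) G(3)]) (use assms in auto)
  then show ?thesis unfolding has_ded_def
    by (intro exI[of _ ?D]) (use D E G in \<open>auto simp: neutral_def[of "Infer _ _ _"] lessThan_Suc\<close>)
qed

lemma core_BotE_prime:
  assumes "core \<Gamma> Falsum" "formula ar A" "prime A"
  shows "core \<Gamma> A"
proof -
  obtain D where D: "deduction ar D" "is_normal D" "concl D = Falsum" "open_asms D \<subseteq> \<Gamma>" "\<not> ends_EqI D"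
    using assms(1) unfolding has_ded_def by blast
  have "atomic A" using assms(3) by (cases A) auto
  then have "deduction ar (Infer (BotE 0) A [D])" using D assms by (intro deduction.BotE) auto
  then show ?thesis unfolding has_ded_def
    by (intro exI[of _ "Infer (BotE 0) A [D]"]) (use D in \<open>auto simp: ends_EqI_def\<close>)
qed

lemma core_BotE_discharging:
  assumes D: "deduction ar D" "is_normal D" "concl D = Falsum" "open_asms D \<subseteq> insert (0, Neg A) \<Gamma>"
    "\<not> ends_EqI D" and A: "formula ar A" "atomic A" and n: "(0, Neg A) \<in> open_asms D"
  shows "core \<Gamma> A"
proof -
  have "deduction ar (Infer (BotE 0) A [D])" using assms by (intro deduction.BotE) auto
  then show ?thesis unfolding has_ded_def
    by (intro exI[of _ "Infer (BotE 0) A [D]"]) (use D in \<open>auto simp: ends_EqI_def\<close>)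
qed

text \<open>
  If \<open>A\<close> is not prime, $(\bot E_C)$ needs a non-vacuous discharge.  When the given refutation does
  not use $\neg A$, it proves $\iota x\neg\neg A = b$ by \<open>IotaI\<close>; from there $\neg\neg A$ is obtained by an
  elimination, so that $\neg A$ can be used as a minor premise without creating a maximal formula.
\<close>

lemma core_BotE:
  assumes bot: "core (insert (0, Neg A) \<Gamma>) Falsum" and fin: "finite \<Gamma>"
    and A: "formula ar A" "atomic A"
  shows "core \<Gamma> A"
proof -
  obtain D where D: "deduction ar D" "is_normal D" "concl D = Falsum" "open_asms D \<subseteq> insert (0, Neg A) \<Gamma>"
    "\<not> ends_EqI D"
    using bot unfolding has_ded_def by blast
  show ?thesis
  proof (cases "(0, Neg A) \<in> open_asms D")
    case True
    then show ?thesis using core_BotE_discharging[OF D A] by simp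
  next
    case False
    then have "open_asms D \<subseteq> \<Gamma>" using D(4) by blast
    then have b: "core \<Gamma> Falsum" unfolding has_ded_def using D by blast
    let ?F = "Imp (Neg A) Falsum" and ?c = "Par 0" and ?d = "Par 1"
    obtain a where a: "a \<notin> params_ctx \<Gamma> \<union> params_fm A \<union> {0, 1}"
      using ex_fresh finite_params_ctx[OF fin] finite_params(2)[of A] by (metis finite.emptyI finite.insertI finite_UnI)
    have fv: "fv_fm A = {}" using A by (simp add: formula_def)
    \<comment> \<open>\<open>A\<close> is closed, so the description binds vacuously and each
      instance of its scope is \<open>?F\<close> itself.\<close>
    have F: "subst_fm x t ?F = ?F" for x t using fv by (simp add: subst_notin)
    have p: "core \<Delta> B" if "prime B" "formula ar B" "\<Gamma> \<subseteq> \<Delta>" for \<Delta> B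
      using core_BotE_prime[OF has_ded_mono[OF b that(3)] that(2,1)] by simp
    have nF: "normal \<Gamma> ?F"
      by (intro core_normal core_ImpI has_ded_mono[OF b]) (use A in \<open>auto simp: formula_def\<close>)
    have I: "core \<Gamma> (Ident (Iota 0 ?F) ?c)"
    proof (rule core_IotaI(1)[where b = a])
      show "normal (insert (0, Ident (Par a) ?c) \<Gamma>) (subst_fm 0 (Par a) ?F)"
        unfolding F by (rule has_ded_mono[OF nF]) auto
      show "a \<notin> params_ctx \<Gamma>" "a \<notin> params_fm ?F" "a \<notin> params_tm ?c" using a by auto
    qed (auto intro!: core_normal p simp: formula_def)
    \<comment> \<open>\<open>IotaE1\<close> directly below \<open>IotaI\<close> would be maximal.
      Absurdity also yields the identity of \<open>?c\<close> and \<open>?d\<close>, and replacing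
      one by the other interposes an \<open>EqE\<close>. The two parameters only have to be
      distinct, not fresh.\<close>
    have "core \<Gamma> (Ident ?c ?d)" by (rule p) (auto simp: formula_def)
    then have "has_ded (\<lambda>D. root D = Some EqE) \<Gamma> (subst_fm 0 ?d (Ident (Iota 0 ?F) (Var 0)))"
      by (rule has_ded_EqE) (use core_normal[OF I] in auto)
    then have "has_ded (\<lambda>D. neutral D \<or> root D = Some EqE) \<Gamma> (Ident (Iota 0 ?F) ?d)"
      by (simp, elim has_ded_mono) auto
    then have "neu \<Gamma> (subst_fm 0 ?d ?F)"
      by (rule neu_IotaE1) (auto intro!: core_normal p simp: formula_def)
    then have "neu \<Gamma> ?F" by (simp only: F)
    then obtain E where E: "deduction ar E" "is_normal E" "concl E = ?F" "open_asms E \<subseteq> \<Gamma>" "neutral E"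
      unfolding has_ded_def by blast
    let ?E = "Infer ImpE Falsum [E, Assume 0 (Neg A)]"
    have "deduction ar ?E"
      by (rule deduction.ImpE[OF E(1) deduction.Assume E(3)]) (use A in \<open>auto simp: formula_def\<close>)
    then show ?thesis
      by (rule core_BotE_discharging) (use E A in \<open>auto simp: ends_EqI_def lessThan_Suc\<close>)
  qed
qed

text \<open>
  Requiring the premise of \<open>EqI\<close> for cofinitely many parameters lets \<open>EqI\<close> be permuted past other
  inferences without renaming parameters; only \<open>nderives_normal\<close> picks one.
\<close>

inductive nderives :: "(nat \<times> ('c, 'p) fm) set \<Rightarrow> ('c, 'p) fm \<Rightarrow> bool" where
  core: "core \<Gamma> A \<Longrightarrow> nderives \<Gamma> A"
| EqI: "\<lbrakk>core \<Gamma> (Existent s); finite L; \<And>a. a \<notin> L \<Longrightarrow> nderives (insert (1, Ident (Par a) s) \<Gamma>) A\<rbrakk>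
    \<Longrightarrow> nderives \<Gamma> A"

section \<open>Permuting \<open>EqI\<close> with other inferences\<close>

lemma nderives_mono: "nderives \<Gamma> A \<Longrightarrow> \<Gamma> \<subseteq> \<Delta> \<Longrightarrow> nderives \<Delta> A"
proof (induction arbitrary: \<Delta> rule: nderives.induct)
  case (core \<Gamma> A)
  show ?case by (rule nderives.core[OF has_ded_mono[OF core]])
next
  case (EqI \<Gamma> s L A)
  have "core \<Delta> (Existent s)" by (rule has_ded_mono[OF EqI.hyps(1) EqI.prems])
  then show ?case
    by (rule nderives.EqI[OF _ EqI.hyps(2)]) (rule EqI.IH, use EqI.prems in auto)
qed

lemma nderives_normal: "nderives \<Gamma> A \<Longrightarrow> finite \<Gamma> \<Longrightarrow> normal \<Gamma> A"
proof (induction rule: nderives.induct)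
  case (core \<Gamma> A)
  then show ?case by (simp add: core_normal)
next
  case (EqI \<Gamma> s L A)
  obtain D where D: "deduction ar D" "is_normal D" "concl D = Existent s" "open_asms D \<subseteq> \<Gamma>" "\<not> ends_EqI D"
    using EqI.hyps(1) unfolding has_ded_def by blast
  show ?case
  proof (cases "\<exists>t E es. D = Infer AD E es \<and> A = Ident t t \<and> concl (hd es) = Ident t t")
    \<comment> \<open>Here \<open>EqI\<close> would complete a maximal existence segment. But then
      the desired formula already stands above the \<open>AD\<close>, and its deduction there is
      used instead.\<close>
    case True
    then obtain t E es where es: "D = Infer AD E es" "A = Ident t t" "concl (hd es) = Ident t t" by blast
    obtain d where "es = [d]" using D(1) unfolding es(1) by (auto elim: deduction.cases)
    with es D have "deduction ar d" "is_normal d" "concl d = A" "open_asms d \<subseteq> \<Gamma>"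
      by (auto elim: deduction.cases simp: lessThan_Suc)
    then show ?thesis unfolding has_ded_def by blast
  next
    case False
    obtain a where a: "a \<notin> L \<union> params_ctx \<Gamma> \<union> params_tm s \<union> params_fm A"
      using ex_fresh[of "L \<union> params_ctx \<Gamma> \<union> params_tm s \<union> params_fm A"] EqI.hyps(2) EqI.prems
      by (auto simp: finite_params finite_params_ctx)
    then obtain E where E: "deduction ar E" "is_normal E" "concl E = A"
      "open_asms E \<subseteq> insert (1, Ident (Par a) s) \<Gamma>"
      using EqI.IH[of a] EqI.prems unfolding has_ded_def by auto
    let ?D = "Infer (EqI 1 a) A [D, E]"
    have o: "open_asms E - {(1, Ident (Par a) s)} \<subseteq> \<Gamma>" using E(4) by blast
    have "deduction ar ?D"
      by (rule deduction.EqI[OF D(1) E(1) D(3) E(3)]) (use a open_params_ctx[OF o] in auto)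
    moreover have "is_normal ?D" using False D E by auto
    ultimately show ?thesis unfolding has_ded_def
      by (intro exI[of _ ?D]) (use D E o in \<open>auto simp: lessThan_Suc\<close>)
  qed
qed

text \<open>If the major premise ends in applications of \<open>EqI\<close> itself, these are moved
  below the new one; the cofinite choice of parameters prevents clashes.\<close>

lemma nderives_EqI:
  assumes "nderives \<Gamma> E" "E = Existent s" "finite L"
    "\<And>a. a \<notin> L \<Longrightarrow> nderives (insert (1, Ident (Par a) s) \<Gamma>) A"
  shows "nderives \<Gamma> A"
  using assms
proof (induction rule: nderives.induct)
  case (core \<Gamma> B)
  show ?case
    by (rule nderives.EqI[OF _ core.prems(2,3)]) (use core.hyps core.prems(1) in simp)
next
  case (EqI \<Gamma> t L' B)
  show ?case
  proof (rule nderives.EqI[OF EqI.hyps(1,2)])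
    fix a assume "a \<notin> L'"
    then show "nderives (insert (1, Ident (Par a) t) \<Gamma>) A"
      by (rule EqI.IH) (use EqI.prems in \<open>auto intro: nderives_mono\<close>)
  qed
qed

lemma nderives_closed: "nderives \<Gamma> A \<Longrightarrow> fv_fm A = {}"
proof (induction rule: nderives.induct)
  case (EqI \<Gamma> s L A)
  then show ?case using ex_fresh by blast
qed (rule has_ded_closed)

text \<open>Only the \<open>EqI\<close> at the end of the major premise has to be permuted; the
  minor premise may end in any way. If \<open>s = t\<close> the inference would be vacuous, and the
  minor premise is already the conclusion.\<close>

lemma nderives_EqE:
  assumes "nderives \<Gamma> E" "E = Ident s t" "nderives \<Gamma> (subst_fm x s A)" "finite \<Gamma>"
    "atomic (subst_fm x t A)" "\<nexists>u. subst_fm x t A = Existent u"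
  shows "nderives \<Gamma> (subst_fm x t A)"
  using assms
proof (induction rule: nderives.induct)
  case (core \<Gamma> B)
  show ?case
  proof (cases "s = t")
    case True
    then show ?thesis using core by simp
  next
    case False
    have "has_ded (\<lambda>D. root D = Some EqE) \<Gamma> (subst_fm x t A)"
      by (rule has_ded_EqE) (use core False in \<open>auto intro: nderives_normal\<close>)
    then show ?thesis by (rule nderives.core[OF has_ded_mono]) (auto simp: ends_EqI_def)
  qed
next
  case (EqI \<Gamma> u L B)
  show ?case
    by (rule nderives.EqI[OF EqI.hyps(1,2)], rule EqI.IH) (use EqI.prems in \<open>auto intro: nderives_mono\<close>)
qed

text \<open>A fresh assumption \<open>a = s\<close> serves as both premises of \<open>EqE\<close>:
  replacing \<open>a\<close> on the left gives \<open>s = s\<close>, which no longer contains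
  \<open>a\<close>, so \<open>EqI\<close> can discharge the assumption.\<close>

lemma nderives_refl:
  assumes "nderives \<Gamma> (Existent s)" "finite \<Gamma>" "formula ar (Existent s)"
  shows "nderives \<Gamma> (Ident s s)"
proof (rule nderives_EqI[OF assms(1) refl finite_params(1)[of s]])
  fix a assume "a \<notin> params_tm s"
  then have "Par a \<noteq> s" by auto
  have s: "fv_tm s = {}" "arity_tm ar s" using assms(3) by (auto simp: formula_def)
  let ?\<Delta> = "insert (1, Ident (Par a) s) \<Gamma>"
  have c: "nderives ?\<Delta> (Ident (Par a) s)"
    by (rule nderives.core, rule core_Assume[of 1]) (use s in \<open>auto simp: formula_def\<close>)
  have "nderives ?\<Delta> (subst_fm 0 s (Ident (Var 0) s))"
    by (rule nderives_EqE[OF c refl]) (use c s assms(2) in \<open>auto simp: subst_notin\<close>)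
  then show "nderives ?\<Delta> (Ident s s)" using s by (simp add: subst_notin)
qed

text \<open>
  An \<open>EqI\<close> concluding $\bot$ must not stand above $(\bot E_C)$, nor can it be moved below, since its
  major premise may depend on $\neg A$.  It is made to conclude \<open>A\<close> instead, and $\bot$ is then
  inferred from \<open>A\<close> and the assumption $\neg A$.
\<close>

lemma nderives_BotE:
  assumes "nderives \<Delta> B" "B = Falsum" "\<Delta> \<subseteq> insert (0, Neg A) \<Gamma>" "finite \<Gamma>" "formula ar A" "atomic A"
  shows "nderives \<Gamma> A"
  using assms
proof (induction arbitrary: \<Gamma> rule: nderives.induct)
  case (core \<Delta> B)
  have "core (insert (0, Neg A) \<Gamma>) Falsum"
    by (rule has_ded_mono[OF core.hyps(1)[unfolded core.prems(1)] core.prems(2)])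
  then show ?case by (rule nderives.core[OF core_BotE[OF _ core.prems(3-5)]])
next
  case (EqI \<Delta> s L B)
  let ?\<Gamma> = "insert (0, Neg A) \<Gamma>"
  have "nderives ?\<Gamma> A"
  proof (rule nderives.EqI)
    show "core ?\<Gamma> (Existent s)" by (rule has_ded_mono[OF EqI.hyps(1) EqI.prems(2)])
    show "finite L" by fact
    fix a assume "a \<notin> L"
    then have "nderives (insert (1, Ident (Par a) s) \<Gamma>) A"
      by (rule EqI.IH) (use EqI.prems in auto)
    then show "nderives (insert (1, Ident (Par a) s) ?\<Gamma>) A" by (rule nderives_mono) auto
  qed
  then have "normal ?\<Gamma> A" using EqI.prems by (simp add: nderives_normal)
  then have "neu ?\<Gamma> Falsum"
    by (rule neu_ImpE[OF neu_Assume[of "Neg A"], rotated 2])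
      (use EqI.prems in \<open>auto simp: formula_def\<close>)
  then show ?case by (rule nderives.core[OF core_BotE[OF neu_core EqI.prems(3-5)]])
qed

end

section \<open>Saturation and the truth lemma\<close>

text \<open>For \<open>ForallI\<close>, \<open>EqE\<close> and \<open>IotaI\<close>, whose premises
  show only an instance of the formula in question.\<close>

lemma arity_subst_rev:
  fixes s :: "('c, 'p) tm" and A :: "('c, 'p) fm"
  shows "arity_tm ar (subst_tm x t s) \<Longrightarrow> arity_tm ar s"
    and "arity_fm ar (subst_fm x t A) \<Longrightarrow> arity_fm ar A"
  by (induction s and A) (auto simp: list_all_iff split: if_splits)

lemma countable_symbols:
  fixes s :: "('c, 'p) tm" and A :: "('c, 'p) fm"
  shows "countable (set1_tm s) \<and> countable (set2_tm s)"
    and "countable (set1_fm A) \<and> countable (set2_fm A)"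
  by (induction s and A) (auto intro!: countable_UN intro: countable_finite)

lemma atomic_tm_arity: "atomic_tm t \<Longrightarrow> arity_tm ar t"
  by (cases t) auto

lemma deduction_arity: "deduction ar D \<Longrightarrow> arity_fm ar (concl D)"
proof (induction rule: deduction.induct)
  case (ForallI D x a A u)
  then show ?case by (auto dest: arity_subst_rev)
next
  case (ForallE D1 D2 x A t B)
  then show ?case by (simp add: arity_subst atomic_tm_arity)
next
  case (EqE D1 D2 t1 t2 x A B)
  then show ?case using arity_subst_rev(2)[of ar x t1 A] by (simp add: arity_subst)
next
  case (IotaI D D1 D2 t x a F u)
  then show ?case by (auto dest: arity_subst_rev)
next
  case (IotaE1 D1 D2 x F t u B)
  then show ?case by (simp add: arity_subst atomic_tm_arity)
qed (auto simp: formula_def list_all_iff)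

lemma deduction_formula: "deduction ar D \<Longrightarrow> formula ar (concl D)"
  by (simp add: formula_def deduction_closed deduction_arity)

lemma deduction_open_asms:
  "deduction ar D \<Longrightarrow> finite (open_asms D) \<and> (\<forall>(u, B)\<in>open_asms D. formula ar B)"
  by (induction rule: deduction.induct) (auto simp: lessThan_Suc numeral_2_eq_2)

text \<open>A record of reading introduction rules backwards: what they would discharge is put into
  the context, and an atomic formula ends with its negation there. Label 0 makes all these entries
  neutral.\<close>

inductive falsified :: "(nat \<times> ('c, 'p) fm) set \<Rightarrow> ('c, 'p) fm \<Rightarrow> bool" for H where
  atomic: "atomic A \<Longrightarrow> (0, Neg A) \<in> H \<Longrightarrow> falsified H A"
| Falsum: "falsified H Falsum"
| Imp: "(0, A) \<in> H \<Longrightarrow> falsified H B \<Longrightarrow> falsified H (Imp A B)"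
| Forall: "(0, Existent (Par a)) \<in> H \<Longrightarrow> falsified H (subst_fm x (Par a) A) \<Longrightarrow>
    falsified H (Forall x A)"

lemma falsified_mono: "falsified H A \<Longrightarrow> H \<subseteq> K \<Longrightarrow> falsified K A"
  by (induction rule: falsified.induct) (auto intro: falsified.intros)

inductive_cases falsified_ImpE: "falsified H (Imp A B)"
inductive_cases falsified_ForallE: "falsified H (Forall x A)"
inductive_cases falsified_ExistentE: "falsified H (Existent s)"
inductive_cases falsified_IdentE: "falsified H (Ident s t)"
inductive_cases falsified_PredE: "falsified H (Pred p ts)"

definition iota_decided where
  "iota_decided ar H x F a \<longleftrightarrow>
     nderives ar H (Ident (Iota x F) (Par a)) \<and> nderives ar H (Existent (Iota x F)) \<or>
     falsified H (Existent (Par a)) \<or>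
     (\<exists>b. (0, Ident (Par b) (Par a)) \<in> H \<and> falsified H (subst_fm x (Par b) F)) \<or>
     (\<exists>b. (0, subst_fm x (Par b) F) \<in> H \<and> (0, Existent (Par b)) \<in> H \<and>
        falsified H (Ident (Par b) (Par a)))"

text \<open>The extra clauses provide what the denotation of terms requires. A witness has label 1
  since it comes from \<open>EqI\<close>; it differs from \<open>s\<close>, so \<open>AD\<close>
  yields its existence.\<close>

definition decided where
  "decided ar H A \<longleftrightarrow> (nderives ar H A \<or> falsified H A) \<and>
     (\<forall>s. A = Existent s \<longrightarrow> falsified H A \<or> (\<exists>a. a \<notin> params_tm s \<and> (1, Ident (Par a) s) \<in> H)) \<and>
     (\<forall>x F a. A = Ident (Iota x F) (Par a) \<longrightarrow> iota_decided ar H x F a)"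

section \<open>Extending consistent contexts\<close>

locale lang =
  fixes ar :: "'p \<Rightarrow> nat" and C :: "'c set" and P :: "'p set"
begin

definition in_lang :: "('c, 'p) fm \<Rightarrow> bool" where
  "in_lang A \<longleftrightarrow> formula ar A \<and> set1_fm A \<subseteq> C \<and> set2_fm A \<subseteq> P"

definition consistent :: "(nat \<times> ('c, 'p) fm) set \<Rightarrow> bool" where
  "consistent \<Gamma> \<longleftrightarrow> finite \<Gamma> \<and> (\<forall>(u, B)\<in>\<Gamma>. in_lang B) \<and> \<not> nderives ar \<Gamma> Falsum"

lemma in_lang_simps [simp]:
  "in_lang (Imp A B) \<longleftrightarrow> in_lang A \<and> in_lang B"
  "in_lang Falsum"
  "in_lang (Existent (Par a))"
  "in_lang (Ident s t) \<longleftrightarrow> in_lang (Existent s) \<and> in_lang (Existent t)"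
  by (auto simp: in_lang_def formula_def)

lemma in_lang_Pred: "in_lang (Pred p ts) \<Longrightarrow> t \<in> set ts \<Longrightarrow> in_lang (Existent t)"
  by (fastforce simp: in_lang_def formula_def list_all_iff)

lemma in_lang_binder:
  "in_lang (Forall x A) \<Longrightarrow> in_lang (subst_fm x (Par a) A)"
  "in_lang (Existent (Iota x A)) \<Longrightarrow> in_lang (subst_fm x (Par a) A)"
  using consts_subst(2)[of x "Par a" A] preds_subst(2)[of x "Par a" A]
  by (auto simp: in_lang_def formula_def fv_subst arity_subst)

lemma in_lang_formula: "in_lang A \<Longrightarrow> formula ar A"
  by (simp add: in_lang_def)

text \<open>If the conclusion of an introduction is underivable, so is its premise in the enlarged
  context. For atomic formulas \<open>BotE\<close> takes the part of the introduction.\<close>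

lemma falsify:
  assumes "\<not> nderives ar \<Gamma> A" "in_lang A" "finite \<Gamma>" "\<forall>(u, B)\<in>\<Gamma>. in_lang B"
  shows "\<exists>\<Delta>. \<Gamma> \<subseteq> \<Delta> \<and> consistent \<Delta> \<and> falsified \<Delta> A"
  using assms
proof (induction "size A" arbitrary: A \<Gamma> rule: less_induct)
  case less
  have at: ?case if "atomic A"
  proof (intro exI[of _ "insert (0, Neg A) \<Gamma>"] conjI)
    have "\<not> nderives ar (insert (0, Neg A) \<Gamma>) Falsum"
      using nderives_BotE[OF _ refl subset_refl less.prems(3) in_lang_formula[OF less.prems(2)] that]
        less.prems(1) by blast
    then show "consistent (insert (0, Neg A) \<Gamma>)" using less.prems by (simp add: consistent_def)
  qed (use that in \<open>auto intro: falsified.atomic\<close>)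
  show ?case
  proof (cases A)
    case Falsum
    then show ?thesis using less.prems
      by (intro exI[of _ \<Gamma>]) (auto simp: consistent_def intro: falsified.intros)
  next
    case (Imp B E)
    have "\<not> nderives ar (insert (0, B) \<Gamma>) E"
    proof
      assume "nderives ar (insert (0, B) \<Gamma>) E"
      then have "normal ar (insert (0, B) \<Gamma>) E" using less.prems by (simp add: nderives_normal)
      then have "core ar \<Gamma> (Imp B E)"
        by (rule core_ImpI) (use less.prems Imp in \<open>simp add: in_lang_formula\<close>)
      then show False using less.prems Imp nderives.core by blast
    qed
    then obtain \<Delta> where "insert (0, B) \<Gamma> \<subseteq> \<Delta>" "consistent \<Delta>" "falsified \<Delta> E"
      using less.hyps[of E "insert (0, B) \<Gamma>"] less.prems Imp by auto
    then show ?thesis using Imp by (intro exI[of _ \<Delta>]) (auto intro: falsified.intros)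
  next
    case (Forall x B)
    obtain a where a: "a \<notin> params_ctx \<Gamma> \<union> params_fm B"
      using ex_fresh finite_params_ctx[OF less.prems(3)] finite_params(2)[of B] by (metis finite_UnI)
    let ?\<Gamma> = "insert (0, Existent (Par a)) \<Gamma>" and ?B = "subst_fm x (Par a) B"
    have "\<not> nderives ar ?\<Gamma> ?B"
    proof
      assume "nderives ar ?\<Gamma> ?B"
      then have "normal ar ?\<Gamma> ?B" using less.prems by (simp add: nderives_normal)
      then have "core ar \<Gamma> (Forall x B)" by (rule core_ForallI) (use a in auto)
      then show False using less.prems Forall nderives.core by blast
    qed
    then obtain \<Delta> where "?\<Gamma> \<subseteq> \<Delta>" "consistent \<Delta>" "falsified \<Delta> ?B"
      using less.hyps[of ?B ?\<Gamma>] less.prems Forall in_lang_binder(1)[of x B a]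
      by (auto simp: size_subst_Par)
    then show ?thesis using Forall by (intro exI[of _ \<Delta>]) (auto intro: falsified.intros)
  qed (use at in auto)
qed

text \<open>Otherwise \<open>EqI\<close> would conclude absurdity from the existence of
  \<open>s\<close>.\<close>

lemma add_witness:
  assumes "consistent \<Gamma>" "nderives ar \<Gamma> (Existent s)" "in_lang (Existent s)"
  shows "\<exists>a. a \<notin> params_tm s \<and> consistent (insert (1, Ident (Par a) s) \<Gamma>)"
proof (rule ccontr)
  assume "\<not> ?thesis"
  then have "nderives ar (insert (1, Ident (Par a) s) \<Gamma>) Falsum" if "a \<notin> params_tm s" for a
    using that assms unfolding consistent_def by auto
  then have "nderives ar \<Gamma> Falsum"
    by (rule nderives_EqI[OF assms(2) refl finite_params(1)])
  then show False using assms(1) by (simp add: consistent_def)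
qed

text \<open>Were all premises of \<open>IotaI\<close> derivable for a fresh \<open>b\<close>, the
  identity would follow, and also the existence of the description by an \<open>AD\<close> directly
  below. So one premise can be falsified.\<close>

lemma decide_iota:
  assumes \<Gamma>: "consistent \<Gamma>" and L: "in_lang (Existent (Iota x F))"
  shows "\<exists>\<Delta>. \<Gamma> \<subseteq> \<Delta> \<and> consistent \<Delta> \<and> iota_decided ar \<Delta> x F a"
proof (cases "nderives ar \<Gamma> (Ident (Iota x F) (Par a)) \<and> nderives ar \<Gamma> (Existent (Iota x F))")
  case True
  then show ?thesis using \<Gamma> unfolding iota_decided_def by blast
next
  case False
  have fin: "finite \<Gamma>" and lg: "\<forall>(u, B)\<in>\<Gamma>. in_lang B" using \<Gamma> by (auto simp: consistent_def)
  obtain b where b: "b \<notin> params_ctx \<Gamma> \<union> params_fm F \<union> {a}"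
    using ex_fresh finite_params_ctx[OF fin] finite_params(2)[of F]
    by (metis finite.emptyI finite.insertI finite_UnI)
  let ?F = "subst_fm x (Par b) F" and ?E = "Existent (Par b)" and ?I = "Ident (Par b) (Par a)"
  have F: "in_lang ?F" using L by (rule in_lang_binder)
  have "\<not> nderives ar \<Gamma> (Existent (Par a)) \<or> \<not> nderives ar (insert (0, ?I) \<Gamma>) ?F \<or>
    \<not> nderives ar (insert (0, ?F) (insert (0, ?E) \<Gamma>)) ?I"
  proof (rule ccontr)
    assume "\<not> ?thesis"
    then have n: "normal ar \<Gamma> (Existent (Par a))" "normal ar (insert (0, ?I) \<Gamma>) ?F"
      "normal ar (insert (0, ?F) (insert (0, ?E) \<Gamma>)) ?I"
      using fin by (simp_all add: nderives_normal)
    have "core ar \<Gamma> (Ident (Iota x F) (Par a))"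
      by (rule core_IotaI(1)[OF n(1) _ n(2,3)]) (use b in auto)
    moreover have "core ar \<Gamma> (Existent (Iota x F))"
      by (rule core_IotaI(2)[OF n(1) _ n(2,3)]) (use b in auto)
    ultimately show False using False nderives.core by blast
  qed
  then consider "\<not> nderives ar \<Gamma> (Existent (Par a))" | "\<not> nderives ar (insert (0, ?I) \<Gamma>) ?F"
    | "\<not> nderives ar (insert (0, ?F) (insert (0, ?E) \<Gamma>)) ?I" by blast
  then show ?thesis
  proof cases
    case 1
    from falsify[OF 1 _ fin lg] show ?thesis unfolding iota_decided_def by auto
  next
    case 2
    from falsify[OF 2 F] fin lg obtain \<Delta> where
      "insert (0, ?I) \<Gamma> \<subseteq> \<Delta>" "consistent \<Delta>" "falsified \<Delta> ?F" by auto
    then show ?thesis unfolding iota_decided_def by (intro exI[of _ \<Delta>]) blast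
  next
    case 3
    from falsify[OF 3] fin lg F obtain \<Delta> where
      "insert (0, ?F) (insert (0, ?E) \<Gamma>) \<subseteq> \<Delta>" "consistent \<Delta>" "falsified \<Delta> ?I" by auto
    then show ?thesis unfolding iota_decided_def by (intro exI[of _ \<Delta>]) blast
  qed
qed

lemma decide:
  assumes \<Gamma>: "consistent \<Gamma>" and A: "in_lang A"
  shows "\<exists>\<Delta>. \<Gamma> \<subseteq> \<Delta> \<and> consistent \<Delta> \<and> decided ar \<Delta> A"
proof -
  have "\<exists>\<Delta>. \<Gamma> \<subseteq> \<Delta> \<and> consistent \<Delta> \<and> (nderives ar \<Delta> A \<or> falsified \<Delta> A)"
  proof (cases "nderives ar \<Gamma> A")
    case False
    from falsify[OF this A] \<Gamma> show ?thesis by (auto simp: consistent_def)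
  qed (use \<Gamma> in blast)
  then obtain \<Delta> where \<Delta>: "\<Gamma> \<subseteq> \<Delta>" "consistent \<Delta>" "nderives ar \<Delta> A \<or> falsified \<Delta> A" by blast
  show ?thesis
  proof (cases "\<exists>s. A = Existent s")
    case True
    then obtain s where s: "A = Existent s" by blast
    show ?thesis
    proof (cases "falsified \<Delta> A")
      case True
      then show ?thesis using \<Delta> s by (intro exI[of _ \<Delta>]) (auto simp: decided_def)
    next
      case False
      then obtain a where a: "a \<notin> params_tm s" "consistent (insert (1, Ident (Par a) s) \<Delta>)"
        using add_witness[of \<Delta> s] \<Delta> s A by blast
      have "nderives ar (insert (1, Ident (Par a) s) \<Delta>) A"
        by (rule nderives_mono[of ar \<Delta>]) (use \<Delta> False in auto)
      then show ?thesis using a \<Delta> s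
        by (intro exI[of _ "insert (1, Ident (Par a) s) \<Delta>"]) (auto simp: decided_def)
    qed
  next
    case ne: False
    show ?thesis
    proof (cases "\<exists>x F a. A = Ident (Iota x F) (Par a)")
      case True
      then obtain x F a where i: "A = Ident (Iota x F) (Par a)" by blast
      then have "in_lang (Existent (Iota x F))" using A by simp
      from decide_iota[OF \<Delta>(2) this, of a] obtain \<Theta> where \<Theta>: "\<Delta> \<subseteq> \<Theta>" "consistent \<Theta>" "iota_decided ar \<Theta> x F a"
        by blast
      have "nderives ar \<Theta> A \<or> falsified \<Theta> A"
        using \<Delta>(3) nderives_mono[OF _ \<Theta>(1)] falsified_mono[OF _ \<Theta>(1)] by blast
      then show ?thesis using \<Delta>(1) \<Theta> i
        by (intro exI[of _ \<Theta>]) (auto simp: decided_def)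
    next
      case False
      then show ?thesis using \<Delta> ne by (intro exI[of _ \<Delta>]) (auto simp: decided_def)
    qed
  qed
qed

lemma saturate:
  assumes "countable C" "countable P" "consistent \<Gamma>"
  obtains G where "G 0 = \<Gamma>" "\<And>n. G n \<subseteq> G (Suc n)" "\<And>n. consistent (G n)"
    "\<And>A. in_lang A \<Longrightarrow> \<exists>n. decided ar (G n) A"
proof -
  have "countable {A. in_lang A}"
    by (rule countable_subset[OF _ countable_fms[OF assms(1,2)]]) (auto simp: in_lang_def)
  then obtain en :: "nat \<Rightarrow> ('c, 'p) fm" where en: "{A. in_lang A} \<subseteq> range en"
    by (metis countable_empty empty_subsetI range_from_nat_into subset_refl)
  have "\<exists>G. \<forall>n. (consistent (G n) \<and> (n = 0 \<longrightarrow> G n = \<Gamma>)) \<and>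
    (G n \<subseteq> G (Suc n) \<and> (in_lang (en n) \<longrightarrow> decided ar (G (Suc n)) (en n)))"
  proof (rule dependent_nat_choice[where P = "\<lambda>n x. consistent x \<and> (n = 0 \<longrightarrow> x = \<Gamma>)" and
        Q = "\<lambda>n x y. x \<subseteq> y \<and> (in_lang (en n) \<longrightarrow> decided ar y (en n))"])
    show "\<exists>x. consistent x \<and> (0 = (0::nat) \<longrightarrow> x = \<Gamma>)" using assms(3) by blast
    fix x and n :: nat
    assume x: "consistent x \<and> (n = 0 \<longrightarrow> x = \<Gamma>)"
    show "\<exists>y. (consistent y \<and> (Suc n = 0 \<longrightarrow> y = \<Gamma>)) \<and> x \<subseteq> y \<and>
        (in_lang (en n) \<longrightarrow> decided ar y (en n))"
    proof (cases "in_lang (en n)")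
      case True
      with decide x show ?thesis by (metis nat.distinct(1))
    next
      case False
      with x show ?thesis by blast
    qed
  qed
  then obtain G where G: "\<forall>n. consistent (G n) \<and> (n = 0 \<longrightarrow> G n = \<Gamma>)"
    "\<forall>n. G n \<subseteq> G (Suc n) \<and> (in_lang (en n) \<longrightarrow> decided ar (G (Suc n)) (en n))" by blast
  show ?thesis
  proof (rule that[of G])
    fix A
    assume A: "in_lang A"
    then obtain n where "A = en n" using en by blast
    then show "\<exists>n. decided ar (G n) A" using A G(2) by blast
  qed (use G in auto)
qed

end

section \<open>The model of a saturated chain\<close>

locale saturated = lang ar C P for ar :: "'p \<Rightarrow> nat" and C :: "'c set" and P :: "'p set" +
  fixes G :: "nat \<Rightarrow> (nat \<times> ('c, 'p) fm) set"
  assumes chain: "\<And>n. G n \<subseteq> G (Suc n)"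
    and cons: "\<And>n. consistent (G n)"
    and dec: "\<And>A. in_lang A \<Longrightarrow> \<exists>n. decided ar (G n) A"
begin

definition "H = (\<Union>n. G n)"
text \<open>Derivability at some stage rather than from the union \<open>H\<close>: a stage is
  finite and leaves fresh parameters for the rules that need them.\<close>

definition "prov A \<longleftrightarrow> (\<exists>n. nderives ar (G n) A)"
definition "ext A \<longleftrightarrow> (\<exists>n. neu ar (G n) A)"

lemma G_mono: "m \<le> n \<Longrightarrow> G m \<subseteq> G n"
  using lift_Suc_mono_le[of G] chain by blast

lemma G_finite [simp]: "finite (G n)"
  using cons by (simp add: consistent_def)

text \<open>Premises derived at different stages are all available from some stage on;
  \<open>sequentially\<close> does the bookkeeping.\<close>

lemma prov_eventually: "prov A \<Longrightarrow> \<forall>\<^sub>F n in sequentially. nderives ar (G n) A"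
  unfolding prov_def eventually_sequentially using nderives_mono G_mono by blast

lemma normal_eventually: "prov A \<Longrightarrow> \<forall>\<^sub>F n in sequentially. normal ar (G n) A"
  by (drule prov_eventually, erule eventually_mono) (rule nderives_normal[OF _ G_finite])

lemma ext_eventually: "ext A \<Longrightarrow> \<forall>\<^sub>F n in sequentially. neu ar (G n) A"
  unfolding ext_def eventually_sequentially by (meson G_mono has_ded_mono)

lemma in_H_eventually: "z \<in> H \<Longrightarrow> \<forall>\<^sub>F n in sequentially. z \<in> G n"
  unfolding H_def eventually_sequentially using G_mono by blast

lemma provI: "\<forall>\<^sub>F n in sequentially. nderives ar (G n) A \<Longrightarrow> prov A"
  unfolding prov_def by (rule eventually_happens') auto

lemma extI: "\<forall>\<^sub>F n in sequentially. neu ar (G n) A \<Longrightarrow> ext A"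
  unfolding ext_def by (rule eventually_happens') auto

lemma ext_prov: "ext A \<Longrightarrow> prov A"
  unfolding ext_def prov_def using nderives.core neu_core by blast

lemma not_prov_Falsum: "\<not> prov Falsum"
  using cons by (simp add: prov_def consistent_def)

lemma in_H_lang: "(u, A) \<in> H \<Longrightarrow> in_lang A"
  using cons unfolding H_def consistent_def by blast

lemma in_H_ext: "(0, A) \<in> H \<Longrightarrow> ext A"
  using in_H_eventually[of "(0, A)"] in_H_lang[of 0 A]
  by (intro extI) (auto elim!: eventually_mono intro: neu_Assume in_lang_formula)

text \<open>Modus ponens in the form that survives without cut: a neutral major premise and an
  arbitrary minor one.\<close>

lemma ext_Imp: "ext (Imp A B) \<Longrightarrow> prov A \<Longrightarrow> ext B"
  by (drule ext_eventually, drule normal_eventually, rule extI, erule (1) eventually_elim2)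
    (rule neu_ImpE)

lemma not_prov_Neg: "(0, Neg A) \<in> H \<Longrightarrow> \<not> prov A"
  using in_H_ext ext_Imp ext_prov not_prov_Falsum by blast

lemma falsified_G: "falsified (G n) A \<Longrightarrow> falsified H A"
  by (erule falsified_mono) (auto simp: H_def)

lemma prov_or_falsified: "in_lang A \<Longrightarrow> prov A \<or> falsified H A"
  using dec[of A] falsified_G unfolding decided_def prov_def by blast

lemma prov_closed: "prov A \<Longrightarrow> fv_fm A = {}"
  unfolding prov_def using nderives_closed by blast

lemma prov_EqE:
  assumes "prov (Ident s t)" "prov (subst_fm x s A)"
    "atomic (subst_fm x t A)" "\<nexists>u. subst_fm x t A = Existent u"
  shows "prov (subst_fm x t A)"
  using prov_eventually[OF assms(1)] prov_eventually[OF assms(2)]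
  by (intro provI, eventually_elim) (rule nderives_EqE[OF _ refl], use assms in auto)

lemma prov_refl: "prov (Existent s) \<Longrightarrow> in_lang (Existent s) \<Longrightarrow> prov (Ident s s)"
  using in_lang_formula G_finite unfolding prov_def by (meson nderives_refl)

lemma prov_Ident_left:
  assumes "prov (Ident s s')" "prov (Ident s t)"
  shows "prov (Ident s' t)"
proof -
  have c: "fv_tm t = {}" using prov_closed[OF assms(2)] by simp
  have "prov (subst_fm 0 s' (Ident (Var 0) t))"
    by (rule prov_EqE[OF assms(1)]) (use assms(2) c in \<open>auto simp: subst_notin\<close>)
  then show ?thesis using c by (simp add: subst_notin)
qed

lemma prov_Ident_right:
  assumes "prov (Ident t t')" "prov (Ident s t)"
  shows "prov (Ident s t')"
proof -
  have c: "fv_tm s = {}" using prov_closed[OF assms(2)] by simp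
  have "prov (subst_fm 0 t' (Ident s (Var 0)))"
    by (rule prov_EqE[OF assms(1)]) (use assms(2) c in \<open>auto simp: subst_notin\<close>)
  then show ?thesis using c by (simp add: subst_notin)
qed

lemma prov_sym:
  "prov (Ident s t) \<Longrightarrow> prov (Existent s) \<Longrightarrow> in_lang (Existent s) \<Longrightarrow> prov (Ident t s)"
  using prov_Ident_left prov_refl by blast

text \<open>Arguments are replaced one by one: \<open>us\<close> collects those already treated and
  \<open>Var 0\<close> marks the current place, which is safe as all other arguments are
  closed.\<close>

lemma prov_Pred_replace:
  assumes "list_all2 (\<lambda>s t. prov (Ident s t)) ss ts" "prov (Pred p (us @ ss))"
  shows "prov (Pred p (us @ ts))"
  using assms
proof (induction arbitrary: us rule: list_all2_induct)
  case (Cons s ss t ts)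
  have c: "fv_tm u = {}" if "u \<in> set us \<union> set ss" for u
    using prov_closed[OF Cons.prems] that by auto
  have m: "map (subst_tm 0 r) us = us" "map (subst_tm 0 r) ss = ss" for r
    using c by (auto intro!: map_idI simp: subst_notin)
  have "prov (subst_fm 0 t (Pred p (us @ Var 0 # ss)))"
    by (rule prov_EqE[OF Cons.hyps(1)]) (use Cons.prems m in auto)
  then have "prov (Pred p ((us @ [t]) @ ss))" using m by simp
  from Cons.IH[OF this] show ?case by simp
qed simp

definition "exist a \<longleftrightarrow> prov (Existent (Par a))"
text \<open>The least parameter stands for its class, so the objects of the model are parameters and
  can be named in formulas.\<close>

definition "rep a = (LEAST b. exist b \<and> prov (Ident (Par a) (Par b)))"
definition "domain = {d. exist d \<and> rep d = d}"
definition "param_val a = (if exist a then Some (rep a) else None)"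
definition "const_val c = (if \<exists>d. d \<in> domain \<and> prov (Existent (Const c)) \<and> prov (Ident (Par d) (Const c))
  then Some (SOME d. d \<in> domain \<and> prov (Existent (Const c)) \<and> prov (Ident (Par d) (Const c))) else None)"
definition "pred_val p ds \<longleftrightarrow> prov (Pred p (map Par ds))"

abbreviation "denotes s \<equiv> den domain const_val pred_val param_val s Map.empty"
abbreviation "holds A \<equiv> sat domain const_val pred_val param_val A Map.empty"

lemma exist_refl: "exist a \<Longrightarrow> prov (Ident (Par a) (Par a))"
  by (simp add: exist_def prov_refl)

lemma exist_sym: "exist a \<Longrightarrow> prov (Ident (Par a) t) \<Longrightarrow> prov (Ident t (Par a))"
  by (rule prov_sym) (simp_all add: exist_def)

lemma rep:
  assumes "exist a"
  shows "exist (rep a)" "prov (Ident (Par a) (Par (rep a)))"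
  using LeastI[of "\<lambda>b. exist b \<and> prov (Ident (Par a) (Par b))" a] assms exist_refl
  unfolding rep_def by blast+

lemma rep_cong:
  assumes "exist a" "prov (Ident (Par a) (Par b))"
  shows "rep a = rep b"
proof -
  have "prov (Ident (Par a) (Par c)) = prov (Ident (Par b) (Par c))" for c
    using assms exist_sym prov_Ident_left by blast
  then show ?thesis by (simp add: rep_def)
qed

lemma rep_in_domain: "exist a \<Longrightarrow> rep a \<in> domain"
  unfolding domain_def using rep rep_cong by (metis (mono_tags, lifting) mem_Collect_eq)

lemma domain_eqI: "d \<in> domain \<Longrightarrow> d' \<in> domain \<Longrightarrow> prov (Ident (Par d) (Par d')) \<Longrightarrow> d = d'"
  unfolding domain_def using rep_cong by (metis (mono_tags, lifting) mem_Collect_eq)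

lemma ran_param_val: "ran param_val \<subseteq> domain"
  by (auto simp: ran_def param_val_def rep_in_domain)

lemma const_val_Some:
  "const_val c = Some d \<Longrightarrow> d \<in> domain \<and> prov (Existent (Const c)) \<and> prov (Ident (Par d) (Const c))"
  unfolding const_val_def by (metis (mono_tags, lifting) option.distinct(1) option.inject someI_ex)

lemma ran_const_val: "ran const_val \<subseteq> domain"
  using const_val_Some by (auto simp: ran_def)

lemma holds_subst:
  "d \<in> domain \<Longrightarrow> holds (subst_fm x (Par d) A) \<longleftrightarrow> sat domain const_val pred_val param_val A (Map.empty(x \<mapsto> d))"
  by (simp add: den_sat_subst domain_def param_val_def)

lemma holds_subst_rep:
  "exist a \<Longrightarrow> holds (subst_fm x (Par a) A) \<longleftrightarrow> sat domain const_val pred_val param_val A (Map.empty(x \<mapsto> rep a))"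
  by (simp add: den_sat_subst param_val_def)

text \<open>Two implications instead of an equivalence with \<open>prov\<close>, for which cut would
  be needed. By \<open>prov_or_falsified\<close> the second one still makes every true formula of
  the language derivable.\<close>

definition "faithful A \<longleftrightarrow> (ext A \<longrightarrow> holds A) \<and> (falsified H A \<longrightarrow> \<not> holds A)"

lemma term_witness:
  assumes s: "in_lang (Existent s)" "prov (Existent s)"
  obtains a where "exist a" "(1, Ident (Par a) s) \<in> H" "prov (Ident (Par a) s)"
proof -
  have is_normal: "\<not> falsified (G n) (Existent s)" for n
    using falsified_G[of n "Existent s"] not_prov_Neg s(2) by (auto elim: falsified_ExistentE)
  with dec[OF s(1)] obtain n a where a: "a \<notin> params_tm s" "(1, Ident (Par a) s) \<in> G n"
    unfolding decided_def by blast
  have f: "formula ar (Ident (Par a) s)" using s(1) by (intro in_lang_formula) simp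
  have "nderives ar (G n) (Ident (Par a) s)" by (rule nderives.core[OF core_Assume[OF a(2) f]])
  moreover have "nderives ar (G n) (Existent (Par a))"
    by (rule nderives.core[OF core_AD_Assume[OF a(2) f]]) (use a(1) in auto)
  ultimately show ?thesis using a(2) that unfolding exist_def prov_def H_def by blast
qed

lemma den_of_prov:
  assumes s: "in_lang (Existent s)" "prov (Existent s)"
    and IH: "\<And>x F b. s = Iota x F \<Longrightarrow> faithful (subst_fm x (Par b) F)"
  shows "\<exists>d\<in>domain. denotes s = Some d \<and> prov (Ident s (Par d))"
proof -
  obtain a where a: "exist a" "(1, Ident (Par a) s) \<in> H" "prov (Ident (Par a) s)"
    using term_witness[OF s] by blast
  let ?d = "rep a"
  have sa: "prov (Ident s (Par a))" using a exist_sym by blast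
  have sd: "prov (Ident s (Par ?d))" using prov_Ident_right[OF rep(2)[OF a(1)] sa] .
  have "denotes s = Some ?d"
  proof (cases s)
    case (Par b)
    then have "exist b" using s(2) by (simp add: exist_def)
    then show ?thesis using a(1,3) rep_cong Par by (simp add: param_val_def)
  next
    case (Const c)
    have "prov (Ident (Par ?d) (Const c))"
      using prov_Ident_left[OF rep(2)[OF a(1)]] a(3) Const by blast
    then have "const_val c \<noteq> None" using s(2) Const rep_in_domain[OF a(1)] unfolding const_val_def by auto
    then obtain d where d: "const_val c = Some d" by auto
    have "prov (Ident (Par d) (Par ?d))" using prov_Ident_right[of s "Par ?d" "Par d"] sd const_val_Some[OF d] Const by blast
    then have "d = ?d" using domain_eqI const_val_Some[OF d] rep_in_domain[OF a(1)] by blast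
    then show ?thesis using Const d by simp
  next
    case (Var x)
    then show ?thesis using s(1) by (simp add: in_lang_def formula_def)
  next
    case (Iota x F)
    have "formula ar (Ident (Par a) s)" using s(1) by (intro in_lang_formula) simp
    have c: "subst_fm 0 t (Ident (Var 0) (Par a)) = Ident t (Par a)" for t :: "('c, 'p) tm" by simp
    \<comment> \<open>\<open>IotaE1\<close> and \<open>IotaE2\<close> need the description on the
      left and a major premise that is no introduction. Replacing the first \<open>a\<close> in
      \<open>a = a\<close> by means of the witness gives such an identity, concluded by
      \<open>EqE\<close>.\<close>
    have ev: "\<forall>\<^sub>F n in sequentially. has_ded ar (\<lambda>D. neutral D \<or> root D = Some EqE) (G n) (Ident (Iota x F) (Par a))"
      using in_H_eventually[OF a(2)] normal_eventually[OF exist_refl[OF a(1)]]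
    proof eventually_elim
      case (elim n)
      have "core ar (G n) (Ident (Par a) (Iota x F))"
        using core_Assume elim(1) \<open>formula ar (Ident (Par a) s)\<close> Iota by blast
      then have "has_ded ar (\<lambda>D. root D = Some EqE) (G n) (subst_fm 0 (Iota x F) (Ident (Var 0) (Par a)))"
        by (rule has_ded_EqE) (use elim(2) in auto)
      then show ?case unfolding c by (rule has_ded_mono) auto
    qed
    have "\<forall>\<^sub>F n in sequentially. neu ar (G n) (subst_fm x (Par a) F)"
      using ev normal_eventually[OF exist_refl[OF a(1)]]
      by eventually_elim (rule neu_IotaE1, auto)
    then have "ext (subst_fm x (Par a) F)" by (rule extI)
    then have "holds (subst_fm x (Par a) F)" using IH[OF Iota] by (simp add: faithful_def)
    then have ha: "sat domain const_val pred_val param_val F (Map.empty(x \<mapsto> ?d))" using holds_subst_rep[OF a(1)] by blast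
    \<comment> \<open>True instances are not falsified, hence derivable, so \<open>IotaE2\<close>
      applies to \<open>d'\<close>.\<close>
    have "d' = ?d" if d': "d' \<in> domain" "sat domain const_val pred_val param_val F (Map.empty(x \<mapsto> d'))" for d'
    proof -
      have "holds (subst_fm x (Par d') F)" using d' holds_subst by blast
      then have "\<not> falsified H (subst_fm x (Par d') F)" using IH[OF Iota] by (auto simp: faithful_def)
      then have p: "prov (subst_fm x (Par d') F)"
        using prov_or_falsified in_lang_binder(2) s(1) Iota by blast
      have "prov (Existent (Par d'))" using d'(1) by (simp add: domain_def exist_def)
      from ev normal_eventually[OF p] normal_eventually[OF this]
      have "\<forall>\<^sub>F n in sequentially. neu ar (G n) (Ident (Par d') (Par a))"
        by eventually_elim (rule neu_IotaE2, auto)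
      then have "prov (Ident (Par d') (Par a))" using extI ext_prov by blast
      moreover have "exist d'" using d'(1) by (simp add: domain_def)
      ultimately have "rep d' = rep a" by (intro rep_cong)
      then show ?thesis using d'(1) by (simp add: domain_def)
    qed
    then show ?thesis unfolding Iota
      by (intro den_Iota_eq_Some[THEN iffD2] conjI ballI impI rep_in_domain[OF a(1)] ha)
  qed
  then show ?thesis using sd rep_in_domain[OF a(1)] by blast
qed

text \<open>For a description this rests on \<open>iota_decided\<close> at its value
  \<open>d\<close>: each failing premise of \<open>IotaI\<close> contradicts that \<open>d\<close>
  exists, satisfies \<open>F\<close>, or is the only object to do so.\<close>

lemma prov_of_den:
  assumes s: "in_lang (Existent s)" "denotes s = Some d"
    and IH: "\<And>x F b. s = Iota x F \<Longrightarrow> faithful (subst_fm x (Par b) F)"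
  shows "prov (Ident (Par d) s) \<and> prov (Existent s)"
proof (cases s)
  case (Par b)
  then have "exist b" "d = rep b" using s(2) by (auto simp: param_val_def split: if_splits)
  then show ?thesis using rep exist_sym Par by (simp add: exist_def)
next
  case (Const c)
  then show ?thesis using s(2) const_val_Some by auto
next
  case (Var x)
  then show ?thesis using s(2) by simp
next
  case (Iota x F)
  have d: "d \<in> domain" "sat domain const_val pred_val param_val F (Map.empty(x \<mapsto> d))"
    and u: "\<forall>d'\<in>domain. sat domain const_val pred_val param_val F (Map.empty(x \<mapsto> d')) \<longrightarrow> d' = d"
    using den_Iota_eq_Some[THEN iffD1, OF s(2)[unfolded Iota]] by blast+
  have ed: "exist d" using d(1) by (simp add: domain_def)
  have "in_lang (Ident (Iota x F) (Par d))" using s(1) Iota by simp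
  from dec[OF this] obtain n where "iota_decided ar (G n) x F d" unfolding decided_def by blast
  then consider "prov (Ident (Iota x F) (Par d))" "prov (Existent (Iota x F))"
    | "falsified H (Existent (Par d))"
    | b where "(0, Ident (Par b) (Par d)) \<in> H" "falsified H (subst_fm x (Par b) F)"
    | b where "(0, subst_fm x (Par b) F) \<in> H" "(0, Existent (Par b)) \<in> H"
        "falsified H (Ident (Par b) (Par d))"
    unfolding iota_decided_def prov_def using falsified_G by (fastforce simp: H_def)
  then show ?thesis
  proof cases
    case 1
    then show ?thesis using prov_sym s(1) Iota by blast
  next
    case 2
    then show ?thesis using not_prov_Neg ed by (auto simp: exist_def elim: falsified_ExistentE)
  next
    case 3
    have "ext (Ident (Par b) (Par d))" using 3(1) by (rule in_H_ext)
    moreover from this obtain n where "core ar (G n) (Existent (Par b))"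
      unfolding ext_def using core_AD_Ident by blast
    ultimately have b: "prov (Ident (Par b) (Par d))" "exist b"
      using nderives.core ext_prov by (auto simp: exist_def prov_def)
    then have "rep b = rep d" by (intro rep_cong)
    then have "rep b = d" using d(1) by (simp add: domain_def)
    then have "holds (subst_fm x (Par b) F)" using d(2) b(2) holds_subst_rep by blast
    then show ?thesis using 3(2) IH[OF Iota] by (auto simp: faithful_def)
  next
    case 4
    have b: "exist b" using in_H_ext[OF 4(2)] ext_prov by (simp add: exist_def)
    have "holds (subst_fm x (Par b) F)" using in_H_ext[OF 4(1)] IH[OF Iota] by (auto simp: faithful_def)
    then have "rep b = d" using u b holds_subst_rep rep_in_domain by blast
    then have "prov (Ident (Par b) (Par d))" using rep(2)[OF b] by simp
    then show ?thesis using 4(3) not_prov_Neg by (auto elim: falsified_IdentE)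
  qed
qed

text \<open>The induction is on size because terms contain formulas: even an atomic formula depends
  on instances of the scopes of descriptions among its arguments.\<close>

lemma faithful: "in_lang A \<Longrightarrow> faithful A"
proof (induction "size A" arbitrary: A rule: less_induct)
  case less
  have dp: "\<exists>d\<in>domain. denotes s = Some d \<and> prov (Ident s (Par d))"
    if "size s < size A" "in_lang (Existent s)" "prov (Existent s)" for s
    by (rule den_of_prov[OF that(2,3)])
      (use that less.hyps in_lang_binder(2) in \<open>auto simp: size_subst_Par\<close>)
  have pd: "prov (Ident (Par d) s) \<and> prov (Existent s)"
    if "size s < size A" "in_lang (Existent s)" "denotes s = Some d" for s d
    by (rule prov_of_den[OF that(2,3)])
      (use that less.hyps in_lang_binder(2) in \<open>auto simp: size_subst_Par\<close>)
  show ?case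
  proof (cases A)
    case (Pred p ts)
    have sz: "size t < size A" if "t \<in> set ts" for t using size_arg[OF that] Pred by simp
    have lg: "in_lang (Existent t)" if "t \<in> set ts" for t using in_lang_Pred that less.prems Pred by blast
    have "holds A" if e: "ext A"
    proof -
      have "prov (Existent t)" if "t \<in> set ts" for t
        using e core_AD_Pred[OF _ that] nderives.core unfolding ext_def prov_def Pred by blast
      then have "\<forall>t\<in>set ts. \<exists>d. denotes t = Some d \<and> prov (Ident t (Par d))"
        using dp sz lg by blast
      then obtain f where f: "\<And>t. t \<in> set ts \<Longrightarrow> denotes t = Some (f t) \<and> prov (Ident t (Par (f t)))"
        by metis
      have "list_all2 (\<lambda>s t. prov (Ident s t)) ts (map Par (map f ts))"
        using f by (auto simp: list_all2_conv_all_nth)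
      from prov_Pred_replace[OF this, of p "[]"] have "pred_val p (map f ts)"
        using ext_prov[OF e] Pred by (simp add: pred_val_def)
      moreover have "map denotes ts = map Some (map f ts)" using f by simp
      ultimately show ?thesis
        unfolding Pred sat.simps by (intro exI[of _ "map f ts"]) (simp add: comp_def)
    qed
    moreover have "\<not> holds A" if "falsified H A"
    proof
      assume "holds A"
      then obtain ds where ds: "map denotes ts = map Some ds" "pred_val p ds"
        unfolding Pred sat.simps list.map_comp comp_def by blast
      have l: "length ts = length ds" using ds(1) map_eq_imp_length_eq by blast
      have "denotes (ts ! i) = Some (ds ! i)" if "i < length ts" for i
        using ds(1) that l by (metis nth_map)
      then have "list_all2 (\<lambda>s t. prov (Ident s t)) (map Par ds) ts"
        using pd sz lg l by (simp add: list_all2_conv_all_nth)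
      from prov_Pred_replace[OF this, of p "[]"] have "prov A" using ds(2) Pred by (simp add: pred_val_def)
      moreover have "(0, Neg A) \<in> H" using that Pred by (auto elim: falsified_PredE)
      ultimately show False using not_prov_Neg by blast
    qed
    ultimately show ?thesis by (simp add: faithful_def)
  next
    case (Existent s)
    have sz: "size s < size A" and lg: "in_lang (Existent s)" using less.prems Existent by auto
    have "holds A" if "ext A" using dp[OF sz lg] ext_prov[OF that] Existent by auto
    moreover have "\<not> holds A" if "falsified H A"
      using pd[OF sz lg] that not_prov_Neg Existent
      by (cases "denotes s") (auto elim!: falsified_ExistentE)
    ultimately show ?thesis by (simp add: faithful_def)
  next
    case (Ident s t)
    have sz: "size s < size A" "size t < size A" and lg: "in_lang (Existent s)" "in_lang (Existent t)"
      using less.prems Ident by auto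
    have "holds A" if e: "ext A"
    proof -
      have p: "prov (Existent s)" "prov (Existent t)"
        using e core_AD_Ident nderives.core unfolding ext_def prov_def Ident by blast+
      obtain d d' where d: "d \<in> domain" "denotes s = Some d" "prov (Ident s (Par d))"
        and d': "d' \<in> domain" "denotes t = Some d'" "prov (Ident t (Par d'))"
        using dp[OF sz(1) lg(1) p(1)] dp[OF sz(2) lg(2) p(2)] by blast
      have "prov (Ident s (Par d'))"
        using prov_Ident_right[OF d'(3)] ext_prov[OF e] Ident by blast
      then have "d = d'" using prov_Ident_left[OF d(3)] domain_eqI d(1) d'(1) by blast
      then show ?thesis using d d' Ident by simp
    qed
    moreover have "\<not> holds A" if "falsified H A"
    proof
      assume "holds A"
      then obtain d where "denotes s = Some d" "denotes t = Some d" using Ident by auto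
      then have "prov A" using pd[OF sz(1) lg(1)] pd[OF sz(2) lg(2)] prov_Ident_left Ident by blast
      moreover have "(0, Neg A) \<in> H" using that Ident by (auto elim: falsified_IdentE)
      ultimately show False using not_prov_Neg by blast
    qed
    ultimately show ?thesis by (simp add: faithful_def)
  next
    case Falsum
    then show ?thesis using ext_prov not_prov_Falsum by (auto simp: faithful_def)
  next
    case (Imp B E)
    have IH: "faithful B" "faithful E" and B: "in_lang B" using less Imp by auto
    \<comment> \<open>If \<open>B\<close> holds it is not falsified, hence derivable, and
      \<open>ext_Imp\<close> applies.\<close>
    have "holds A" if "ext A"
      using that Imp ext_Imp prov_or_falsified[OF B] IH by (auto simp: faithful_def)
    moreover have "\<not> holds A" if "falsified H A"
      using that Imp in_H_ext IH by (auto simp: faithful_def elim: falsified_ImpE)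
    ultimately show ?thesis by (simp add: faithful_def)
  next
    case (Forall x B)
    have IH: "faithful (subst_fm x (Par a) B)" for a
      by (rule less.hyps) (use less.prems Forall in \<open>auto simp: size_subst_Par in_lang_binder(1)\<close>)
    have "holds A" if "ext A"
    proof -
      have "sat domain const_val pred_val param_val B (Map.empty(x \<mapsto> d))" if d: "d \<in> domain" for d
      proof -
        have "prov (Existent (Par d))" using d by (simp add: domain_def exist_def)
        from normal_eventually[OF this] ext_eventually[OF \<open>ext A\<close>]
        have "\<forall>\<^sub>F n in sequentially. neu ar (G n) (subst_fm x (Par d) B)"
          unfolding Forall by eventually_elim (rule neu_ForallE, auto)
        then show ?thesis using extI IH holds_subst[OF d] by (auto simp: faithful_def)
      qed
      then show ?thesis using Forall by simp
    qed
    moreover have "\<not> holds A" if f: "falsified H A"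
    proof -
      obtain a where a: "(0, Existent (Par a)) \<in> H" "falsified H (subst_fm x (Par a) B)"
        using f Forall by (auto elim: falsified_ForallE)
      have "exist a" using in_H_ext[OF a(1)] ext_prov by (simp add: exist_def)
      then have "\<not> sat domain const_val pred_val param_val B (Map.empty(x \<mapsto> rep a))" "rep a \<in> domain"
        using a(2) IH[of a] holds_subst_rep rep_in_domain by (auto simp: faithful_def)
      then show ?thesis using Forall by auto
    qed
    ultimately show ?thesis by (simp add: faithful_def)
  qed
qed

end

section \<open>Completeness and the normal deduction\<close>

lemma normal_completeness:
  fixes D :: "('c, 'p) ded"
  assumes D: "deduction ar D"
  shows "nderives ar ((\<lambda>B. (0, B)) ` open_formulas D) (concl D)"
proof (rule ccontr)
  \<comment> \<open>Relabelling all open assumptions by 0 makes them neutral.\<close>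
  let ?\<Gamma> = "(\<lambda>B. (0, B)) ` open_formulas D"
  assume n: "\<not> nderives ar ?\<Gamma> (concl D)"
  define S where "S = insert (concl D) (open_formulas D)"
  have fin: "finite (open_formulas D)" and fo: "\<forall>B\<in>open_formulas D. formula ar B"
    using deduction_open_asms[OF D] by (auto simp: open_formulas_def)
  have fS: "finite S" using fin by (simp add: S_def)
  interpret lang ar "\<Union>(set1_fm ` S)" "\<Union>(set2_fm ` S)" .
  have lg: "in_lang B" if "B \<in> S" for B
  proof -
    have "formula ar B" using that fo deduction_formula[OF D] by (auto simp: S_def)
    then show ?thesis unfolding in_lang_def using that by blast
  qed
  have S: "concl D \<in> S" "open_formulas D \<subseteq> S" by (auto simp: S_def)
  obtain \<Delta> where \<Delta>: "?\<Gamma> \<subseteq> \<Delta>" "consistent \<Delta>" "falsified \<Delta> (concl D)"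
    using falsify[OF n lg[OF S(1)]] lg S(2) fin by blast
  have ct: "countable (\<Union>(set1_fm ` S))" "countable (\<Union>(set2_fm ` S))"
    using fS countable_symbols(2) by (auto intro!: countable_UN countable_finite[OF fS])
  obtain G where G: "G 0 = \<Delta>" "\<And>n. G n \<subseteq> G (Suc n)" "\<And>n. consistent (G n)"
    "\<And>A. in_lang A \<Longrightarrow> \<exists>n. decided ar (G n) A"
    using saturate[OF ct \<Delta>(2)] by blast
  interpret saturated ar "\<Union>(set1_fm ` S)" "\<Union>(set2_fm ` S)" G
    by unfold_locales (use G in auto)
  have "\<not> holds (concl D)"
    using faithful[OF lg[OF S(1)]] falsified_G[of 0] \<Delta>(3) G(1) by (simp add: faithful_def)
  moreover have "holds B" if "B \<in> open_formulas D" for B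
  proof -
    have "(0, B) \<in> H" using that \<Delta>(1) G(1) by (auto simp: H_def)
    then have "ext B" by (rule in_H_ext)
    then show ?thesis using faithful[OF lg[of B]] that S(2) by (auto simp: faithful_def)
  qed
  ultimately show False using sound[OF ran_const_val D ran_param_val] by blast
qed

theorem theorem7:
  fixes ar :: "'p \<Rightarrow> nat" and \<Gamma> :: "('c, 'p) fm set" and A :: "('c, 'p) fm"
    and D :: "('c, 'p) ded"
  assumes "deduction ar D" and "concl D = A" and "open_formulas D \<subseteq> \<Gamma>"
  shows "\<exists>D'. deduction ar D' \<and> concl D' = A \<and> open_formulas D' \<subseteq> \<Gamma> \<and>
           no_vacuous_EqE D' \<and> normal_form D'"
proof -
  have "finite ((\<lambda>B. (0 :: nat, B)) ` open_formulas D)"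
    using deduction_open_asms[OF assms(1)] by (simp add: open_formulas_def)
  from nderives_normal[OF normal_completeness[OF assms(1)] this]
  obtain D' where D': "deduction ar D'" "is_normal D'" "concl D' = A"
    "open_asms D' \<subseteq> (\<lambda>B. (0, B)) ` open_formulas D"
    unfolding has_ded_def assms(2) by blast
  have "open_formulas D' \<subseteq> \<Gamma>" using D'(4) assms(3) unfolding open_formulas_def by force
  with D' is_normal_normal_form[OF D'(2)] show ?thesis by blast
qed

end
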